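(* Consider the stochastically extended adversarial (SEA) model and the OFTRL learner described in the context. Fix a user-specified parameter $\nu>0$. Under assumptions (A1), (A2), (A3) of the context, OFTRL with $M_t=g_{t-1}$ (and $M_1=0$) and adaptive step size $$\eta_t=\frac{D^2}{\nu+\sum_{s=1}^{t-1}\eta_s\|g_s-M_s\|^2}$$ has, for $u\in\mathscr X$, regret $$\mathbb E[R_T(u)]\le D\big(6\,\bar\sigma_T+3\sqrt2\,\bar\Sigma_T\big)\sqrt T+\frac{3\sqrt2\,DG}{2}+\nu+\frac1\nu\left(4D^2G^2+9L^2D^4\right).$$ The algorithm needs only the knowledge of $D$. With the extra knowledge of $G$ and $L$, one can tune $\nu=LD^2+DG$ to get $$\mathbb E[R_T(u)]\le O\big(D(\bar\sigma_T+\bar\Sigma_T)\sqrt T+DG+LD^2\big).$$ Moreover, if only (A1) (convexity of the individual losses, with gradients bounded by $G$) holds, then tuning $\nu=2DG$ ensures the deterministic bound (without taking expectations) $R_T(u)\le 3\sqrt2\,DG\sqrt T+4DG$.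
   Context: Setting. $\mathscr X\subset\mathbb R^d$ is a closed and bounded convex set, $\|\cdot\|$ is the Euclidean norm, and $D=\sup_{x,y\in\mathscr X}\|x-y\|$. $\Xi$ is a measurable space, $f:\mathscr X\times\Xi\to\mathbb R$, $\nabla f(x,\xi)$ denotes the gradient in $x$, and $\mathfrak D$ is a set of probability distributions on $\Xi$. SEA protocol: in each round $t=1,\dots,T$ the learner chooses $x_t\in\mathscr X$, the adversary picks $\mathscr D_t\in\mathfrak D$ (possibly depending on past actions and realizations), a sample $\xi_t\sim\mathscr D_t$ is observed by both, and the learner suffers loss $f(x_t,\xi_t)$. $\mathbb E$ is the expectation over the joint law of $(x_1,\xi_1,\dots,x_T,\xi_T)$. For $\mathscr D\in\mathfrak D$ let $F^{\mathscr D}(x)=\mathbb E_{\xi\sim\mathscr D}[f(x,\xi)]$, $\nabla F^{\mathscr D}(x)=\mathbb E_{\xi\sim\mathscr D}[\nabla f(x,\xi)]$ and $\sigma_{\mathscr D}^2=\max_{x\in\mathscr X}\mathbb E_{\xi\sim\mathscr D}\|\nabla f(x,\xi)-\nabla F^{\mathscr D}(x)\|^2$. Write $F^t=F^{\mathscr D_t}$ and $\sigma_t^2=\sigma^2_{\mathscr D_t}$, with the convention $F^0:=F^1$. Define $$\bar\sigma_T^2=\frac1T\,\mathbb E\Big[\sum_{t=1}^T\sigma_t^2\Big],\qquad \bar\Sigma_T^2=\frac1T\,\mathbb E\Big[\sum_{t=1}^T\sup_{x\in\mathscr X}\|\nabla F^t(x)-\nabla F^{t-1}(x)\|^2\Big].$$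 Assumptions, for every $\mathscr D\in\mathfrak D$: (A1) $f(\cdot,\xi)$ is convex and its gradients are bounded in norm by $G$ almost surely when $\xi\sim\mathscr D$; (A2) $F^{\mathscr D}$ is $L$-smooth, i.e. $\nabla F^{\mathscr D}$ is $L$-Lipschitz continuous; (A3) $\mathbb E_{\xi\sim\mathscr D}\|\nabla f(x,\xi)-\nabla F^{\mathscr D}(x)\|^2$ is finite for every $x\in\mathscr X$. OFTRL (Optimistic Follow-the-Regularised-Leader): with $g_t=\nabla f(x_t,\xi_t)$ the observed gradient and $M_t\in\mathbb R^d$ the optimistic prediction, $$x_t=\operatorname*{argmin}_{x\in\mathscr X}\Big\{\Big\langle x,\,M_t+\sum_{s=1}^{t-1}g_s\Big\rangle+\frac{\|x\|^2}{\eta_t}\Big\}.$$ Regret: $R_T(u)=\sum_{t=1}^T\langle g_t,x_t-u\rangle$ for $u\in\mathscr X$.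
   Formalization: The formal theorem also assumes that every point of X has norm at most D (true if 0 is in X); without it the claim fails, e.g. X=[2,3], f=-x, ν=1, T=8, because the regulariser is centred at the origin. The O-constant is taken to be 10. *)

theory Defs
  imports "HOL-Probability.Probability"
begin

text \<open>
  \<open>df x \<xi>\<close> is a gradient of \<open>f(\<cdot>, \<xi>)\<close> at \<open>x\<close>, taken relative to \<open>X\<close> because \<open>f(\<cdot>, \<xi>)\<close> is only
  given on \<open>X\<close>. Such a gradient need not be unique (\<open>X\<close> may be lower-dimensional) nor depend
  measurably on \<open>(x, \<xi>)\<close>, so \<open>df\<close> is a parameter and joint measurability is demanded separately.
\<close>

definition gradient_on ::
    "(real^'d) set \<Rightarrow> 'xi measure \<Rightarrow> (real^'d \<Rightarrow> 'xi \<Rightarrow> real) \<Rightarrow> (real^'d \<Rightarrow> 'xi \<Rightarrow> real^'d) \<Rightarrow> bool" where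
  "gradient_on X S f df \<longleftrightarrow>
     (\<forall>x\<in>X. \<forall>\<xi>\<in>space S. ((\<lambda>y. f y \<xi>) has_derivative (\<lambda>h. df x \<xi> \<bullet> h)) (at x within X)) \<and>
     (\<lambda>(x, \<xi>). df x \<xi>) \<in> borel_measurable (restrict_space borel X \<Otimes>\<^sub>M S)"

definition mean_grad :: "(real^'d \<Rightarrow> 'xi \<Rightarrow> real^'d) \<Rightarrow> 'xi measure \<Rightarrow> real^'d \<Rightarrow> real^'d" where
  "mean_grad df \<D> x = (\<integral>\<xi>. df x \<xi> \<partial>\<D>)"

definition grad_variance :: "(real^'d \<Rightarrow> 'xi \<Rightarrow> real^'d) \<Rightarrow> 'xi measure \<Rightarrow> real^'d \<Rightarrow> real" where
  "grad_variance df \<D> x = (\<integral>\<xi>. (norm (df x \<xi> - mean_grad df \<D> x))\<^sup>2 \<partial>\<D>)"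

text \<open>
  A supremum rather than a maximum: gradients may be discontinuous on the boundary of \<open>X\<close>, where
  the maximum need not be attained.
\<close>

definition max_variance :: "(real^'d) set \<Rightarrow> (real^'d \<Rightarrow> 'xi \<Rightarrow> real^'d) \<Rightarrow> 'xi measure \<Rightarrow> real" where
  "max_variance X df \<D> = (SUP x\<in>X. grad_variance df \<D> x)"

definition grad_shift ::
    "(real^'d) set \<Rightarrow> (real^'d \<Rightarrow> 'xi \<Rightarrow> real^'d) \<Rightarrow> 'xi measure \<Rightarrow> 'xi measure \<Rightarrow> real" where
  "grad_shift X df \<D> \<D>' = (SUP x\<in>X. (norm (mean_grad df \<D> x - mean_grad df \<D>' x))\<^sup>2)"

definition convex_bounded_grad ::
    "(real^'d) set \<Rightarrow> (real^'d \<Rightarrow> 'xi \<Rightarrow> real) \<Rightarrow> (real^'d \<Rightarrow> 'xi \<Rightarrow> real^'d) \<Rightarrow> real \<Rightarrow> 'xi measure \<Rightarrow> bool" where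
  "convex_bounded_grad X f df G \<D> \<longleftrightarrow>
     (AE \<xi> in \<D>. convex_on X (\<lambda>x. f x \<xi>) \<and> (\<forall>x\<in>X. norm (df x \<xi>) \<le> G))"

definition smooth_mean ::
    "(real^'d) set \<Rightarrow> (real^'d \<Rightarrow> 'xi \<Rightarrow> real^'d) \<Rightarrow> real \<Rightarrow> 'xi measure \<Rightarrow> bool" where
  "smooth_mean X df L \<D> \<longleftrightarrow> L-lipschitz_on X (mean_grad df \<D>)"

definition finite_variance ::
    "(real^'d) set \<Rightarrow> (real^'d \<Rightarrow> 'xi \<Rightarrow> real^'d) \<Rightarrow> 'xi measure \<Rightarrow> bool" where
  "finite_variance X df \<D> \<longleftrightarrow>
     (\<forall>x\<in>X. integrable \<D> (\<lambda>\<xi>. (norm (df x \<xi> - mean_grad df \<D> x))\<^sup>2))"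

text \<open>
  The information available after round \<open>t\<close> is \<open>\<F> t\<close>. The adversary's choice \<open>\<D> t\<close> may depend on
  everything known before round \<open>t\<close> (including its own randomisation), and given that information
  the sample \<open>\<xi> t\<close> has distribution \<open>\<D> t\<close>. The actions of a deterministic learner are functions of
  the past samples and therefore do not enlarge the filtration.
\<close>

definition sea_protocol ::
    "'xi measure \<Rightarrow> 'xi measure set \<Rightarrow> nat \<Rightarrow> 'w measure \<Rightarrow> (nat \<Rightarrow> 'w measure) \<Rightarrow>
     (nat \<Rightarrow> 'w \<Rightarrow> 'xi measure) \<Rightarrow> (nat \<Rightarrow> 'w \<Rightarrow> 'xi) \<Rightarrow> bool" where
  "sea_protocol S \<DD> T P \<F> \<D> \<xi> \<longleftrightarrow>
     prob_space P \<and>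
     (\<forall>t\<in>{0..T}. subalgebra P (\<F> t)) \<and>
     (\<forall>t\<in>{1..T}. subalgebra (\<F> t) (\<F> (t - 1))) \<and>
     (\<forall>t\<in>{1..T}.
        \<D> t \<in> \<F> (t - 1) \<rightarrow>\<^sub>M prob_algebra S \<and>
        (\<forall>\<omega>\<in>space P. \<D> t \<omega> \<in> \<DD>) \<and>
        \<xi> t \<in> \<F> t \<rightarrow>\<^sub>M S \<and>
        (\<forall>A\<in>sets S. AE \<omega> in P.
           real_cond_exp P (\<F> (t - 1)) (\<lambda>\<omega>'. indicator A (\<xi> t \<omega>')) \<omega> = measure (\<D> t \<omega>) A))"

text \<open>
  The expectations of the nonnegative sums are taken as \<open>nn_integral\<close>. This is the usual
  expectation whenever the integrand is measurable, and remains meaningful (as a lower integral)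
  when the supremum over the uncountable set \<open>X\<close> is not; the Bochner integral would then be \<open>0\<close>.
\<close>

definition sigma_bar ::
    "(real^'d) set \<Rightarrow> (real^'d \<Rightarrow> 'xi \<Rightarrow> real^'d) \<Rightarrow> nat \<Rightarrow> 'w measure \<Rightarrow> (nat \<Rightarrow> 'w \<Rightarrow> 'xi measure) \<Rightarrow> real" where
  "sigma_bar X df T P \<D> =
     sqrt (1 / real T * enn2real (\<integral>\<^sup>+\<omega>. ennreal (\<Sum>t=1..T. max_variance X df (\<D> t \<omega>)) \<partial>P))"

definition Sigma_bar ::
    "(real^'d) set \<Rightarrow> (real^'d \<Rightarrow> 'xi \<Rightarrow> real^'d) \<Rightarrow> nat \<Rightarrow> 'w measure \<Rightarrow> (nat \<Rightarrow> 'w \<Rightarrow> 'xi measure) \<Rightarrow> real" where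
  "Sigma_bar X df T P \<D> =
     sqrt (1 / real T * enn2real (\<integral>\<^sup>+\<omega>. ennreal
       (\<Sum>t=1..T. grad_shift X df (\<D> t \<omega>) (if t = 1 then \<D> 1 \<omega> else \<D> (t - 1) \<omega>)) \<partial>P))"

text \<open>
  The regulariser is centred at the origin, so guarantees in terms of \<open>diameter X\<close> alone need the
  normalisation \<open>norm y \<le> diameter X\<close> on \<open>X\<close>, which follows from \<open>0 \<in> X\<close>. Without it they fail: on
  \<open>X = {a..a + 1}\<close> with losses \<open>f y \<xi> = - y\<close> the iterate stays at \<open>a\<close> for a number of rounds
  proportional to \<open>a\<close>.
\<close>

definition oftrl ::
    "(real^'d) set \<Rightarrow> nat \<Rightarrow> (nat \<Rightarrow> real) \<Rightarrow> (nat \<Rightarrow> real^'d) \<Rightarrow> (nat \<Rightarrow> real^'d) \<Rightarrow> (nat \<Rightarrow> real^'d) \<Rightarrow> bool" where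
  "oftrl X T \<eta> M g x \<longleftrightarrow>
     (\<forall>t\<in>{1..T}.
        is_arg_min (\<lambda>y. y \<bullet> (M t + (\<Sum>s=1..<t. g s)) + (norm y)\<^sup>2 / \<eta> t) (\<lambda>y. y \<in> X) (x t))"

definition adaptive_step :: "real \<Rightarrow> real \<Rightarrow> nat \<Rightarrow> (nat \<Rightarrow> real^'d) \<Rightarrow> (nat \<Rightarrow> real^'d) \<Rightarrow> (nat \<Rightarrow> real) \<Rightarrow> bool" where
  "adaptive_step D \<nu> T M g \<eta> \<longleftrightarrow>
     (\<forall>t\<in>{1..T}. \<eta> t = D\<^sup>2 / (\<nu> + (\<Sum>s=1..<t. \<eta> s * (norm (g s - M s))\<^sup>2)))"

definition regret :: "nat \<Rightarrow> (nat \<Rightarrow> real^'d) \<Rightarrow> (nat \<Rightarrow> real^'d) \<Rightarrow> real^'d \<Rightarrow> real" where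
  "regret T g x u = (\<Sum>t=1..T. g t \<bullet> (x t - u))"

end

theory Submission
  imports Defs
begin

text \<open>
  The objective of round \<open>t\<close> is a quadratic with leading term \<open>(norm y)\<^sup>2 / \<eta> t\<close>, so it grows
  quadratically away from its minimiser; telescoping over the rounds bounds the regret by \<open>(norm u)\<^sup>2 / \<eta> T\<close>
  plus stability terms, from which a negative multiple of the squared movements of the iterates is kept.
  With \<open>a t = (norm (g t - M t))\<^sup>2\<close>, the adaptive step sizes make the remainder at most
  \<open>\<nu> + 4 D\<^sup>2 G\<^sup>2 / \<nu> + 3/2 sqrt 2 D sqrt (a 1 + \<dots> + a T)\<close> on every path. The bound without expectations
  follows from \<open>a t \<le> 4 G\<^sup>2\<close>. For the bound in expectation, \<open>g t - g (t - 1)\<close> is split into the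
  sampling errors of rounds \<open>t\<close> and \<open>t - 1\<close>, the change of the mean gradient at \<open>x t\<close>, and a
  Lipschitz term in \<open>x t - x (t - 1)\<close> that the negative movement term absorbs; the expectations of
  the square roots are then bounded by Jensen's inequality.
\<close>

subsection \<open>Regret of optimistic follow-the-regularised-leader\<close>

text \<open>Completing the square turns the objective into
  \<open>((norm (p - y))\<^sup>2 - (norm p)\<^sup>2) / \<eta>\<close> with
  \<open>p = - (\<eta> / 2) *\<^sub>R \<theta>\<close>, so minimising it amounts to projecting
  \<open>p\<close> onto \<open>X\<close>. The growth estimate is the obtuse-angle property of the
  projection; the closest-point form later makes the iterates measurable.\<close>

lemma
  fixes X :: "'a::euclidean_space set"
  assumes "closed X" "convex X" "0 < \<eta>"
    and argmin: "is_arg_min (\<lambda>y. y \<bullet> \<theta> + (norm y)\<^sup>2 / \<eta>) (\<lambda>y. y \<in> X) x"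
  shows argmin_eq_closest_point: "x = closest_point X (- (\<eta> / 2) *\<^sub>R \<theta>)"
    and argmin_growth: "y \<in> X \<Longrightarrow>
      x \<bullet> \<theta> + (norm x)\<^sup>2 / \<eta> + (norm (y - x))\<^sup>2 / \<eta> \<le> y \<bullet> \<theta> + (norm y)\<^sup>2 / \<eta>"
proof -
  define p where "p = - (\<eta> / 2) *\<^sub>R \<theta>"
  have obj: "y \<bullet> \<theta> + (norm y)\<^sup>2 / \<eta> = ((norm (p - y))\<^sup>2 - (norm p)\<^sup>2) / \<eta>" for y
    using \<open>0 < \<eta>\<close> unfolding p_def power2_norm_eq_inner
    by (simp add: inner_diff_left inner_diff_right inner_commute field_simps)
  have "x \<in> X" using argmin by (simp add: is_arg_min_def)
  have "\<forall>z\<in>X. dist p x \<le> dist p z"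
  proof
    fix z assume "z \<in> X"
    then have "x \<bullet> \<theta> + (norm x)\<^sup>2 / \<eta> \<le> z \<bullet> \<theta> + (norm z)\<^sup>2 / \<eta>"
      using argmin by (auto simp: is_arg_min_def not_less)
    then have "(norm (p - x))\<^sup>2 \<le> (norm (p - z))\<^sup>2"
      unfolding obj using \<open>0 < \<eta>\<close> by (simp add: divide_le_cancel)
    then show "dist p x \<le> dist p z"
      unfolding dist_norm by (rule power2_le_imp_le) simp
  qed
  note closest = this
  show "x = closest_point X (- (\<eta> / 2) *\<^sub>R \<theta>)"
    using closest_point_unique[OF \<open>convex X\<close> \<open>closed X\<close> \<open>x \<in> X\<close> closest] by (simp add: p_def)
  assume "y \<in> X"
  have "(p - x) \<bullet> (y - x) \<le> 0"
    by (rule any_closest_point_dot[OF \<open>convex X\<close> \<open>closed X\<close> \<open>x \<in> X\<close> \<open>y \<in> X\<close> closest])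
  then have "(norm (p - x))\<^sup>2 + (norm (y - x))\<^sup>2 \<le> (norm (p - y))\<^sup>2"
    unfolding power2_norm_eq_inner by (simp add: inner_diff_left inner_diff_right inner_commute)
  then have "((norm (p - x))\<^sup>2 - (norm p)\<^sup>2) / \<eta> + (norm (y - x))\<^sup>2 / \<eta> \<le> ((norm (p - y))\<^sup>2 - (norm p)\<^sup>2) / \<eta>"
    using \<open>0 < \<eta>\<close> by (simp add: divide_simps)
  then show "x \<bullet> \<theta> + (norm x)\<^sup>2 / \<eta> + (norm (y - x))\<^sup>2 / \<eta> \<le> y \<bullet> \<theta> + (norm y)\<^sup>2 / \<eta>"
    by (simp only: obj)
qed

lemma sum_lag_telescope:
  fixes a b :: "nat \<Rightarrow> real"
  assumes "T \<ge> 1" "\<And>t. t \<in> {1..<T} \<Longrightarrow> a t + b t \<le> a (Suc t)"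
  shows "a 1 + (\<Sum>t=1..<T. b t) \<le> a T"
  using assms
proof (induction T rule: dec_induct)
  case (step n)
  then show ?case
    using step.IH step.prems[of n] step.hyps by (fastforce simp: less_Suc_eq)
qed simp

text \<open>
  The comparator \<open>u\<close> plays the role of the iterate of round \<open>T + 1\<close>, with \<open>\<eta> (T + 1) = \<eta> T\<close>.
\<close>

lemma oftrl_regret_le:
  fixes X :: "(real^'d) set" and x g M :: "nat \<Rightarrow> real^'d"
  assumes "closed X" "convex X" "T \<ge> 1" "u \<in> X"
    and pos: "\<And>t. t \<in> {1..T} \<Longrightarrow> 0 < \<eta> t"
    and dec: "\<And>t. t \<in> {1..<T} \<Longrightarrow> \<eta> (Suc t) \<le> \<eta> t"
    and "M 1 = 0"
    and oftrl: "oftrl X T \<eta> M g x"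
  defines "x' \<equiv> \<lambda>t. if t < T then x (Suc t) else u"
  shows "regret T g x u \<le> (norm u)\<^sup>2 / \<eta> T
    + (\<Sum>t=1..T. (g t - M t) \<bullet> (x t - x' t) - (norm (x t - x' t))\<^sup>2 / \<eta> t)"
proof -
  define H where "H t y = y \<bullet> (M t + (\<Sum>s=1..<t. g s)) + (norm y)\<^sup>2 / \<eta> t" for t y
  have x_in: "x t \<in> X" if "t \<in> {1..T}" for t
    using oftrl that by (auto simp: oftrl_def is_arg_min_def)
  have growth: "H t (x t) + (norm (x t - y))\<^sup>2 / \<eta> t \<le> H t y" if "t \<in> {1..T}" "y \<in> X" for t y
    using argmin_growth[OF \<open>closed X\<close> \<open>convex X\<close> pos[OF that(1)] _ that(2), of _ "x t"] oftrl that
    unfolding H_def oftrl_def by (simp add: norm_minus_commute)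
  define c where "c t = (norm (x t - x' t))\<^sup>2 / \<eta> t + (g t - M t) \<bullet> x' t" for t
  \<comment> \<open>The prediction is subtracted from the telescoped quantity because it only lives
    for one round: passing to round \<open>Suc t\<close> exchanges \<open>M t\<close> for the
    observed \<open>g t\<close>.\<close>
  have "H t (x t) - M t \<bullet> x t + (c t + M t \<bullet> x t) \<le> H (Suc t) (x (Suc t)) - M (Suc t) \<bullet> x (Suc t)"
    if t: "t \<in> {1..<T}" for t
  proof -
    have "H t (x t) + (norm (x t - x (Suc t)))\<^sup>2 / \<eta> t \<le> H t (x (Suc t))"
      using t x_in by (intro growth) auto
    moreover have "(norm (x (Suc t)))\<^sup>2 / \<eta> t \<le> (norm (x (Suc t)))\<^sup>2 / \<eta> (Suc t)"
      using dec[OF t] pos[of t] pos[of "Suc t"] t by (intro divide_left_mono) auto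
    then have "H t (x (Suc t)) + (g t - M t) \<bullet> x (Suc t) \<le> H (Suc t) (x (Suc t)) - M (Suc t) \<bullet> x (Suc t)"
      using t unfolding H_def
      by (simp add: inner_add_right inner_diff_left inner_diff_right inner_commute)
    ultimately show ?thesis
      using t by (simp add: c_def x'_def)
  qed
  from sum_lag_telescope[OF \<open>T \<ge> 1\<close>, of "\<lambda>t. H t (x t) - M t \<bullet> x t" "\<lambda>t. c t + M t \<bullet> x t", OF this]
  have "H 1 (x 1) - M 1 \<bullet> x 1 + (\<Sum>t=1..<T. c t + M t \<bullet> x t) \<le> H T (x T) - M T \<bullet> x T"
    by simp
  \<comment> \<open>No gradient precedes round 1 and \<open>M 1 = 0\<close>, so only the regulariser
    is left.\<close>
  moreover have "0 \<le> H 1 (x 1) - M 1 \<bullet> x 1"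
    using pos[of 1] \<open>T \<ge> 1\<close> \<open>M 1 = 0\<close> by (simp add: H_def)
  \<comment> \<open>Here \<open>u\<close> stands in for the next iterate, and the summand
    \<open>(g T - M T) \<bullet> u\<close> of \<open>c T\<close> exchanges the last prediction for
    the last gradient.\<close>
  moreover have "H T (x T) + c T \<le> (norm u)\<^sup>2 / \<eta> T + (\<Sum>t=1..T. g t) \<bullet> u"
    using growth[of T u] \<open>T \<ge> 1\<close> \<open>u \<in> X\<close>
    by (cases T) (auto simp: c_def H_def x'_def inner_add_right inner_add_left inner_diff_left
        inner_diff_right inner_commute atLeastLessThanSuc_atLeastAtMost)
  moreover have "(\<Sum>t=1..T. c t + M t \<bullet> x t) = (\<Sum>t=1..<T. c t + M t \<bullet> x t) + (c T + M T \<bullet> x T)"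
    using \<open>T \<ge> 1\<close> by (cases T) (auto simp: atLeastLessThanSuc_atLeastAtMost)
  ultimately have "(\<Sum>t=1..T. c t + M t \<bullet> x t) \<le> (norm u)\<^sup>2 / \<eta> T + (\<Sum>t=1..T. g t) \<bullet> u"
    by linarith
  moreover have "regret T g x u = (\<Sum>t=1..T. (g t - M t) \<bullet> (x t - x' t) - (norm (x t - x' t))\<^sup>2 / \<eta> t)
      + (\<Sum>t=1..T. c t + M t \<bullet> x t) - (\<Sum>t=1..T. g t) \<bullet> u"
    unfolding regret_def c_def inner_sum_left sum.distrib[symmetric] sum_subtractf[symmetric]
    by (intro sum.cong) (auto simp: inner_diff_left inner_diff_right)
  ultimately show ?thesis by linarith
qed

subsection \<open>Adaptive step sizes\<close>

text \<open>The normalised potential step: denominator 1 before the step and relative increase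
  \<open>d\<close>. Both sides agree to first order at \<open>d = 0\<close>, which forces the
  constant 3/2; in the variable \<open>s = sqrt (1 + 2 * d)\<close> this tangency becomes the factor
  \<open>(s - 1)\<^sup>2\<close>.\<close>

lemma potential_step_unit:
  fixes d :: real
  assumes "0 \<le> d"
  shows "d / (1 + d) + min (d / 2) (sqrt d) \<le> 3 / 2 * (sqrt (1 + 2 * d) - 1)"
proof -
  define s where "s = sqrt (1 + 2 * d)"
  have "1 \<le> s" using assms by (simp add: s_def)
  have "s\<^sup>2 = 1 + 2 * d" using assms by (simp add: s_def)
  then have d: "d = (s\<^sup>2 - 1) / 2" by simp
  show ?thesis
  \<comment> \<open>Any threshold between 10/3 and 2 + sqrt 3 works. Below it the branch
    \<open>d / 2\<close> of the minimum suffices, as \<open>4 * s - s\<^sup>2 - 1\<close> is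
    nonnegative; above it the branch \<open>sqrt d\<close> does, as \<open>1 + 3 / 4 * s\<close> is
    at most \<open>3 / 2 * (s - 1)\<close>.\<close>
  proof (cases "s \<le> 7 / 2")
    case True
    have "0 \<le> (s - 1) * (7 / 2 - s)" using True \<open>1 \<le> s\<close> by simp
    then have "s\<^sup>2 \<le> 9 / 2 * s - 7 / 2"
      by (simp add: field_simps power2_eq_square)
    then have "0 \<le> 4 * s - s\<^sup>2 - 1" using True by linarith
    then have "0 \<le> (s - 1)\<^sup>2 * (4 * s - s\<^sup>2 - 1)" by simp
    also have "\<dots> = 6 * (s - 1) * (s\<^sup>2 + 1) - 4 * (s\<^sup>2 - 1) - (s\<^sup>2 - 1) * (s\<^sup>2 + 1)"
      by (simp add: algebra_simps power2_eq_square)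
    finally have "(4 * (s\<^sup>2 - 1) + (s\<^sup>2 - 1) * (s\<^sup>2 + 1)) / (4 * (s\<^sup>2 + 1)) \<le> 6 * (s - 1) * (s\<^sup>2 + 1) / (4 * (s\<^sup>2 + 1))"
      by (intro divide_right_mono) auto
    moreover have "0 < s\<^sup>2 + 1" by (simp add: add_nonneg_pos)
    then have "(4 * (s\<^sup>2 - 1) + (s\<^sup>2 - 1) * (s\<^sup>2 + 1)) / (4 * (s\<^sup>2 + 1)) = d / (1 + d) + d / 2"
        "6 * (s - 1) * (s\<^sup>2 + 1) / (4 * (s\<^sup>2 + 1)) = 3 / 2 * (s - 1)"
      unfolding d by (simp_all add: divide_simps) (simp_all add: algebra_simps)
    ultimately have "d / (1 + d) + d / 2 \<le> 3 / 2 * (s - 1)" by (simp only:)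
    then show ?thesis by (simp add: s_def)
  next
    case False
    have "- 8 \<le> s\<^sup>2" by (rule order_trans[OF _ zero_le_power2]) simp
    then have "d \<le> s\<^sup>2 * (9 / 16)" by (simp add: d)
    also have "\<dots> = (3 / 4 * s)\<^sup>2" by (simp add: power_mult_distrib power_divide)
    finally have "sqrt d \<le> 3 / 4 * s" using False by (intro real_le_lsqrt) simp_all
    moreover have "d / (1 + d) \<le> 1" using assms by simp
    ultimately show ?thesis using False by (simp add: s_def)
  qed
qed

text \<open>
  One step \<open>V \<mapsto> V + \<delta>\<close> of the denominator of the step size. The last summand telescopes to at most
  \<open>m / (2 \<nu>)\<close>. Bounding the stability term by \<open>\<delta> / 2\<close> alone would cost \<open>6 D\<^sup>2 G\<^sup>2 / \<nu>\<close> instead of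
  \<open>4 D\<^sup>2 G\<^sup>2 / \<nu>\<close> in the end; the alternative \<open>sqrt (\<delta> * V)\<close>, that is \<open>D\<close> times the gradient error, pays
  for the huge jumps.
\<close>

lemma potential_step:
  fixes V \<delta> B m :: real
  assumes "0 < V" "0 \<le> \<delta>" "0 \<le> B" "B \<le> V\<^sup>2" "2 * \<delta> * V \<le> m"
  shows "\<delta> + min (\<delta> / 2) (sqrt (\<delta> * V))
    \<le> 3 / 2 * (sqrt (B + 2 * \<delta> * V) - sqrt B) + m / 2 * (1 / V - 1 / (V + \<delta>))"
proof -
  \<comment> \<open>Scaling by \<open>V\<close> reduces the main estimate, with
    \<open>V\<^sup>2\<close> in place of \<open>B\<close>, to the unit step.\<close>
  define d where "d = \<delta> / V"
  have "0 \<le> d" and \<delta>: "\<delta> = d * V" using assms by (auto simp: d_def)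
  have "V * (d / (1 + d) + min (d / 2) (sqrt d)) \<le> V * (3 / 2 * (sqrt (1 + 2 * d) - 1))"
    using potential_step_unit[OF \<open>0 \<le> d\<close>] \<open>0 < V\<close> by (intro mult_left_mono) auto
  moreover have "V * sqrt (1 + 2 * d) = sqrt (V\<^sup>2 + 2 * \<delta> * V)"
  proof -
    have "V\<^sup>2 + 2 * \<delta> * V = V\<^sup>2 * (1 + 2 * d)" by (simp add: \<delta> power2_eq_square algebra_simps)
    then show ?thesis using \<open>0 < V\<close> by (simp add: real_sqrt_mult)
  qed
  moreover have "V * min (d / 2) (sqrt d) = min (\<delta> / 2) (sqrt (\<delta> * V))"
  proof -
    have "\<delta> * V = V\<^sup>2 * d" by (simp add: \<delta> power2_eq_square)
    then have "sqrt (\<delta> * V) = V * sqrt d" using \<open>0 < V\<close> by (simp add: real_sqrt_mult)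
    then show ?thesis using \<open>0 < V\<close> by (simp add: \<delta> min_mult_distrib_left mult.commute)
  qed
  ultimately have 1: "V * d / (1 + d) + min (\<delta> / 2) (sqrt (\<delta> * V)) \<le> 3 / 2 * (sqrt (V\<^sup>2 + 2 * \<delta> * V) - V)"
    by (simp add: algebra_simps)
  \<comment> \<open>A fixed increment raises the square root more when it starts from the smaller
    base, and \<open>B \<le> V\<^sup>2\<close>. Rationalising the differences moves the base into
    the denominator.\<close>
  have "sqrt (V\<^sup>2 + 2 * \<delta> * V) - V \<le> sqrt (B + 2 * \<delta> * V) - sqrt B"
  proof (cases "\<delta> = 0")
    case True then show ?thesis using assms by simp
  next
    case False
    let ?c = "2 * \<delta> * V"
    have c: "0 < ?c" using False assms by simp
    have "sqrt (b + ?c) - sqrt b = ?c / (sqrt (b + ?c) + sqrt b)" if "0 \<le> b" for b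
    proof -
      have "(sqrt (b + ?c) - sqrt b) * (sqrt (b + ?c) + sqrt b) = ?c"
        using that c by (simp add: algebra_simps)
      moreover have "0 < sqrt (b + ?c)" using that c by (intro real_sqrt_gt_zero) linarith
      then have "0 < sqrt (b + ?c) + sqrt b" using that by (intro add_pos_nonneg) auto
      ultimately show ?thesis by (simp add: field_simps)
    qed
    note diff = this
    have "?c / (sqrt (V\<^sup>2 + ?c) + sqrt (V\<^sup>2)) \<le> ?c / (sqrt (B + ?c) + sqrt B)"
    proof (intro divide_left_mono add_mono mult_pos_pos add_pos_nonneg)
      show "0 < sqrt (V\<^sup>2 + ?c)" "0 < sqrt (B + ?c)"
        using c \<open>0 \<le> B\<close> zero_le_power2[of V] by (intro real_sqrt_gt_zero; linarith)+
    qed (use c assms in \<open>auto simp del: real_sqrt_abs\<close>)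
    then show ?thesis using diff[of B] diff[of "V\<^sup>2"] assms by simp
  qed
  \<comment> \<open>The excess equals \<open>\<delta>\<^sup>2 / (V + \<delta>)\<close>, which is
    \<open>\<delta> * V\<close> times the drop of the reciprocal of the denominator.\<close>
  moreover have "\<delta> - V * d / (1 + d) \<le> m / 2 * (1 / V - 1 / (V + \<delta>))"
  proof -
    have "1 + d = (V + \<delta>) / V" using \<open>0 < V\<close> by (simp add: d_def field_simps)
    then have "\<delta> - V * d / (1 + d) = (2 * \<delta> * V) / 2 * (1 / V - 1 / (V + \<delta>))"
      using assms \<open>0 \<le> d\<close> by (simp add: \<delta>[symmetric] mult.commute[of V d] divide_simps) (simp add: algebra_simps)
    also have "\<dots> \<le> m / 2 * (1 / V - 1 / (V + \<delta>))"
      using assms by (intro mult_right_mono) (auto simp: divide_simps)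
    finally show ?thesis .
  qed
  ultimately have "\<delta> - V * d / (1 + d) + (V * d / (1 + d) + min (\<delta> / 2) (sqrt (\<delta> * V)))
      \<le> m / 2 * (1 / V - 1 / (V + \<delta>)) + 3 / 2 * (sqrt (B + 2 * \<delta> * V) - sqrt B)"
    using 1 by (intro add_mono) auto
  then show ?thesis by (simp add: add.commute)
qed

text \<open>\<open>V\<close> is the denominator of the step size and \<open>B\<close> collects the
  \<open>a s\<close> seen so far. Since \<open>\<eta> t * a t * V t = D\<^sup>2 * a t\<close>,
  squaring the update of \<open>V\<close> yields \<open>B \<le> V\<^sup>2\<close> inductively;
  \<open>potential_step\<close> then applies in every round, and both of its potentials
  telescope.\<close>

lemma adaptive_step_sum_le:
  fixes a \<eta> :: "nat \<Rightarrow> real"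
  assumes "0 < D" "0 < \<nu>"
    and eta: "\<And>t. t \<in> {1..T} \<Longrightarrow> \<eta> t = D\<^sup>2 / (\<nu> + (\<Sum>s=1..<t. \<eta> s * a s))"
    and "0 \<le> m" and a: "\<And>t. t \<in> {1..T} \<Longrightarrow> 0 \<le> a t" "\<And>t. t \<in> {1..T} \<Longrightarrow> a t \<le> m"
  shows "(\<Sum>t=1..T. \<eta> t * a t + min (\<eta> t * a t / 2) (D * sqrt (a t)))
      \<le> 3 / 2 * sqrt 2 * D * sqrt (\<Sum>t=1..T. a t) + D\<^sup>2 * m / \<nu>"
proof -
  define V where "V t = \<nu> + (\<Sum>s=1..<t. \<eta> s * a s)" for t
  define B where "B t = 2 * D\<^sup>2 * (\<Sum>s=1..<t. a s)" for t
  have V_Suc: "V (Suc t) = V t + \<eta> t * a t" and B_Suc: "B (Suc t) = B t + 2 * D\<^sup>2 * a t"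
    if "t \<ge> 1" for t
    using that by (simp_all add: V_def B_def algebra_simps)
  define b where "b t = \<eta> t * a t + min (\<eta> t * a t / 2) (D * sqrt (a t))" for t
  have inv: "\<nu> \<le> V (Suc n) \<and> 0 \<le> B (Suc n) \<and> B (Suc n) \<le> (V (Suc n))\<^sup>2 \<and>
      (\<Sum>t=1..n. b t) \<le> 3 / 2 * sqrt (B (Suc n)) + D\<^sup>2 * m * (1 / \<nu> - 1 / V (Suc n))"
    if "n \<le> T" for n
    using that
  proof (induction n)
    case 0
    then show ?case by (simp add: V_def B_def)
  next
    case (Suc n)
    let ?t = "Suc n"
    define \<delta> where "\<delta> = \<eta> ?t * a ?t"
    have IH: "\<nu> \<le> V ?t" "0 \<le> B ?t" "B ?t \<le> (V ?t)\<^sup>2"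
      "(\<Sum>t=1..n. b t) \<le> 3 / 2 * sqrt (B ?t) + D\<^sup>2 * m * (1 / \<nu> - 1 / V ?t)"
      using Suc by auto
    have t: "?t \<in> {1..T}" using Suc.prems by simp
    have "0 < V ?t" using IH(1) \<open>0 < \<nu>\<close> by linarith
    have \<eta>: "\<eta> ?t = D\<^sup>2 / V ?t" using eta[OF t] by (simp add: V_def)
    have "0 \<le> \<delta>" using \<open>0 < V ?t\<close> a(1)[OF t] by (simp add: \<delta>_def \<eta>)
    have \<delta>V: "\<delta> * V ?t = D\<^sup>2 * a ?t" using \<open>0 < V ?t\<close> by (simp add: \<delta>_def \<eta>)
    have step: "b ?t \<le> 3 / 2 * (sqrt (B (Suc ?t)) - sqrt (B ?t)) + D\<^sup>2 * m * (1 / V ?t - 1 / V (Suc ?t))"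
    proof -
      \<comment> \<open>The bound called \<open>m\<close> in \<open>potential_step\<close> is
        \<open>2 * (D\<^sup>2 * m)\<close> here; half of it is the coefficient in the
        invariant.\<close>
      have "2 * \<delta> * V ?t \<le> 2 * (D\<^sup>2 * m)"
        using a(2)[OF t] \<open>0 < D\<close> by (simp add: \<delta>V mult.assoc)
      from potential_step[OF \<open>0 < V ?t\<close> \<open>0 \<le> \<delta>\<close> IH(2,3) this]
      show ?thesis
        using \<open>0 < D\<close> V_Suc[of ?t] B_Suc[of ?t]
        by (simp add: b_def \<delta>_def[symmetric] \<delta>V real_sqrt_mult mult.assoc)
    qed
    have "B (Suc ?t) \<le> (V (Suc ?t))\<^sup>2"
    proof -
      have "(V (Suc ?t))\<^sup>2 = (V ?t)\<^sup>2 + 2 * (\<delta> * V ?t) + \<delta>\<^sup>2"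
        using V_Suc[of ?t] by (simp add: \<delta>_def[symmetric] power2_sum)
      then show ?thesis
        using IH(3) B_Suc[of ?t] zero_le_power2[of \<delta>] unfolding \<delta>V mult.assoc by linarith
    qed
    moreover have "\<nu> \<le> V (Suc ?t)" using IH(1) V_Suc[of ?t] \<open>0 \<le> \<delta>\<close> by (simp add: \<delta>_def)
    moreover have "0 \<le> B (Suc ?t)" using IH(2) B_Suc[of ?t] a(1)[OF t] by simp
    moreover have "(\<Sum>t=1..Suc n. b t)
        \<le> 3 / 2 * sqrt (B (Suc ?t)) + D\<^sup>2 * m * (1 / \<nu> - 1 / V (Suc ?t))"
      using IH(4) step by (simp add: algebra_simps)
    ultimately show ?case by blast
  qed
  have "(\<Sum>t=1..T. b t) \<le> 3 / 2 * sqrt (B (Suc T)) + D\<^sup>2 * m * (1 / \<nu> - 1 / V (Suc T))"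
    and "\<nu> \<le> V (Suc T)"
    using inv[of T] by auto
  moreover have "0 \<le> D\<^sup>2 * m * (1 / V (Suc T))"
    using \<open>0 \<le> m\<close> \<open>0 < \<nu>\<close> \<open>\<nu> \<le> V (Suc T)\<close> by simp
  moreover have "sqrt (B (Suc T)) = sqrt 2 * D * sqrt (\<Sum>t=1..T. a t)"
    using \<open>0 < D\<close> by (simp add: B_def real_sqrt_mult atLeastLessThanSuc_atLeastAtMost)
  ultimately show ?thesis by (simp add: b_def algebra_simps)
qed

lemma adaptive_step_pos:
  assumes "0 < D" "0 < \<nu>" "adaptive_step D \<nu> T M g \<eta>" "t \<in> {1..T}"
  shows "0 < \<eta> t"
  using \<open>t \<in> {1..T}\<close>
proof (induction t rule: less_induct)
  case (less t)
  have "0 \<le> \<eta> s * (norm (g s - M s))\<^sup>2" if "s \<in> {1..<t}" for s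
    using less.IH[of s] less.prems that by simp
  then have "0 \<le> (\<Sum>s=1..<t. \<eta> s * (norm (g s - M s))\<^sup>2)" by (intro sum_nonneg)
  then show ?case using assms less.prems by (simp add: adaptive_step_def add_pos_nonneg)
qed

text \<open>The quadratic term of each round is split in two. One half controls the inner product
  with the gradient error, either by Young's inequality or, after being dropped, through the
  diameter; the other half survives as the negative movement term, because
  \<open>1 / \<eta> t\<close> never falls below \<open>\<nu> / D\<^sup>2\<close>.\<close>

lemma oftrl_adaptive_regret_le:
  fixes X :: "(real^'d) set" and x g M :: "nat \<Rightarrow> real^'d"
  assumes X: "closed X" "convex X" "bounded X"
    and D: "D = diameter X" "0 < D" "\<forall>y\<in>X. norm y \<le> D"
    and "T \<ge> 1" "u \<in> X" "0 < \<nu>"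
    and M: "M 1 = 0"
    and step: "adaptive_step D \<nu> T M g \<eta>"
    and oftrl: "oftrl X T \<eta> M g x"
    and m: "\<And>t. t \<in> {1..T} \<Longrightarrow> (norm (g t - M t))\<^sup>2 \<le> m"
  shows "regret T g x u \<le> \<nu> + D\<^sup>2 * m / \<nu>
      + 3 / 2 * sqrt 2 * D * sqrt (\<Sum>t=1..T. (norm (g t - M t))\<^sup>2)
      - \<nu> / (2 * D\<^sup>2) * (\<Sum>t=1..<T. (norm (x t - x (Suc t)))\<^sup>2)"
proof -
  define a where "a t = (norm (g t - M t))\<^sup>2" for t
  define V where "V t = \<nu> + (\<Sum>s=1..<t. \<eta> s * a s)" for t
  have eta: "\<eta> t = D\<^sup>2 / V t" if "t \<in> {1..T}" for t
    using step that by (simp add: adaptive_step_def V_def a_def)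
  have eta_pos: "0 < \<eta> t" if "t \<in> {1..T}" for t
    using adaptive_step_pos[OF \<open>0 < D\<close> \<open>0 < \<nu>\<close> step] that by simp
  have V_ge: "\<nu> \<le> V t" if "t \<in> {1..T}" for t
  proof -
    have "0 \<le> \<eta> s * a s" if "s \<in> {1..<t}" for s
      using eta_pos[of s] that \<open>t \<in> {1..T}\<close> by (simp add: a_def)
    then have "0 \<le> (\<Sum>s=1..<t. \<eta> s * a s)" by (intro sum_nonneg)
    then show ?thesis by (simp add: V_def)
  qed
  have inv_eta: "1 / \<eta> t = V t / D\<^sup>2" if "t \<in> {1..T}" for t
    using eta[OF that] by simp
  have eta_dec: "\<eta> (Suc t) \<le> \<eta> t" if "t \<in> {1..<T}" for t
  proof -
    have "V t \<le> V (Suc t)"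
      using that eta_pos[of t] by (simp add: V_def a_def)
    then show ?thesis
      using that eta[of t] eta[of "Suc t"] V_ge[of t] \<open>0 < \<nu>\<close> by (auto intro!: divide_left_mono)
  qed
  have x_in: "x t \<in> X" if "t \<in> {1..T}" for t
    using oftrl that by (auto simp: oftrl_def is_arg_min_def)
  define x' where "x' t = (if t < T then x (Suc t) else u)" for t
  have "x' t \<in> X" if "t \<in> {1..T}" for t
    using that x_in[of "Suc t"] \<open>u \<in> X\<close> by (simp add: x'_def)
  then have dist_le: "norm (x t - x' t) \<le> D" if "t \<in> {1..T}" for t
    using diameter_bounded_bound[OF \<open>bounded X\<close> x_in[OF that]] that \<open>D = diameter X\<close>
    by (simp add: dist_norm)
  have stab: "(g t - M t) \<bullet> (x t - x' t) - (norm (x t - x' t))\<^sup>2 / \<eta> t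
      \<le> min (\<eta> t * a t / 2) (D * sqrt (a t)) - \<nu> / (2 * D\<^sup>2) * (norm (x t - x' t))\<^sup>2"
    if t: "t \<in> {1..T}" for t
  proof -
    define \<delta> where "\<delta> = norm (x t - x' t)"
    have cs: "(g t - M t) \<bullet> (x t - x' t) \<le> norm (g t - M t) * \<delta>"
      unfolding \<delta>_def by (rule norm_cauchy_schwarz)
    \<comment> \<open>Young's inequality with weight \<open>\<eta> t\<close>, in the form of a
      nonnegative square.\<close>
    have "0 \<le> (\<eta> t * norm (g t - M t) - \<delta>)\<^sup>2 / (2 * \<eta> t)" using eta_pos[OF t] by simp
    also have "\<dots> = \<eta> t * a t / 2 - norm (g t - M t) * \<delta> + \<delta>\<^sup>2 / (2 * \<eta> t)"
      using eta_pos[OF t] by (simp add: a_def field_simps power2_eq_square)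
    finally have 1: "norm (g t - M t) * \<delta> - \<delta>\<^sup>2 / (2 * \<eta> t) \<le> \<eta> t * a t / 2" by simp
    have "norm (g t - M t) * \<delta> \<le> norm (g t - M t) * D"
      using dist_le[OF t] by (intro mult_left_mono) (auto simp: \<delta>_def)
    moreover have "0 \<le> \<delta>\<^sup>2 / (2 * \<eta> t)" using eta_pos[OF t] by simp
    ultimately have 2: "norm (g t - M t) * \<delta> - \<delta>\<^sup>2 / (2 * \<eta> t) \<le> D * sqrt (a t)"
      by (simp add: a_def mult.commute)
    have "\<nu> / D\<^sup>2 \<le> 1 / \<eta> t"
      using V_ge[OF t] \<open>0 < D\<close> by (simp add: inv_eta[OF t] divide_right_mono)
    then have "\<nu> / D\<^sup>2 * (\<delta>\<^sup>2 / 2) \<le> 1 / \<eta> t * (\<delta>\<^sup>2 / 2)"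
      by (intro mult_right_mono) auto
    then have 3: "\<nu> / (2 * D\<^sup>2) * \<delta>\<^sup>2 \<le> \<delta>\<^sup>2 / (2 * \<eta> t)" by (simp add: mult.commute)
    have "\<delta>\<^sup>2 / \<eta> t = \<delta>\<^sup>2 / (2 * \<eta> t) + \<delta>\<^sup>2 / (2 * \<eta> t)" by simp
    then show ?thesis
      unfolding \<delta>_def[symmetric] using cs 1 2 3 by linarith
  qed
  \<comment> \<open>The regulariser at \<open>u\<close> costs at most the denominator
    \<open>V T\<close>, hence one full copy of each \<open>\<eta> t * a t\<close> on top of the
    stability terms.\<close>
  have "(norm u)\<^sup>2 / \<eta> T \<le> D\<^sup>2 * (1 / \<eta> T)"
    using D(3) \<open>u \<in> X\<close> eta_pos[of T] \<open>T \<ge> 1\<close> by (simp add: divide_right_mono power_mono)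
  also have "\<dots> = V T"
    using inv_eta[of T] \<open>T \<ge> 1\<close> \<open>0 < D\<close> by simp
  also have "\<dots> \<le> \<nu> + (\<Sum>t=1..T. \<eta> t * a t)"
    using eta_pos by (simp add: V_def) (intro sum_mono2; force simp: a_def)
  finally have reg: "(norm u)\<^sup>2 / \<eta> T \<le> \<nu> + (\<Sum>t=1..T. \<eta> t * a t)" .
  have "regret T g x u \<le> (norm u)\<^sup>2 / \<eta> T
      + (\<Sum>t=1..T. (g t - M t) \<bullet> (x t - x' t) - (norm (x t - x' t))\<^sup>2 / \<eta> t)"
    unfolding x'_def
    by (rule oftrl_regret_le[OF X(1,2) \<open>T \<ge> 1\<close> \<open>u \<in> X\<close> eta_pos eta_dec M oftrl])
  also have "\<dots> \<le> \<nu> + (\<Sum>t=1..T. \<eta> t * a t) + (\<Sum>t=1..T. min (\<eta> t * a t / 2) (D * sqrt (a t))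
      - \<nu> / (2 * D\<^sup>2) * (norm (x t - x' t))\<^sup>2)"
    by (intro add_mono reg sum_mono stab)
  also have "\<dots> = \<nu> + (\<Sum>t=1..T. \<eta> t * a t + min (\<eta> t * a t / 2) (D * sqrt (a t)))
      - \<nu> / (2 * D\<^sup>2) * (\<Sum>t=1..T. (norm (x t - x' t))\<^sup>2)"
    by (simp add: sum.distrib sum_subtractf sum_distrib_left)
  finally have "regret T g x u \<le> \<nu> + (\<Sum>t=1..T. \<eta> t * a t + min (\<eta> t * a t / 2) (D * sqrt (a t)))
      - \<nu> / (2 * D\<^sup>2) * (\<Sum>t=1..T. (norm (x t - x' t))\<^sup>2)" .
  moreover have "(\<Sum>t=1..T. \<eta> t * a t + min (\<eta> t * a t / 2) (D * sqrt (a t)))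
      \<le> 3 / 2 * sqrt 2 * D * sqrt (\<Sum>t=1..T. a t) + D\<^sup>2 * m / \<nu>"
  proof (rule adaptive_step_sum_le[OF \<open>0 < D\<close> \<open>0 < \<nu>\<close>])
    show "0 \<le> m" using m[of 1] \<open>T \<ge> 1\<close> order_trans[OF zero_le_power2] by auto
  qed (use eta m in \<open>auto simp: V_def a_def\<close>)
  \<comment> \<open>The distance from the last iterate to \<open>u\<close> is discarded; only
    movements between iterates are useful later.\<close>
  moreover have "\<nu> / (2 * D\<^sup>2) * (\<Sum>t=1..<T. (norm (x t - x (Suc t)))\<^sup>2)
      \<le> \<nu> / (2 * D\<^sup>2) * (\<Sum>t=1..T. (norm (x t - x' t))\<^sup>2)"
  proof (intro mult_left_mono)
    have "(\<Sum>t=1..<T. (norm (x t - x (Suc t)))\<^sup>2) = (\<Sum>t=1..<T. (norm (x t - x' t))\<^sup>2)"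
      by (intro sum.cong) (auto simp: x'_def)
    also have "\<dots> \<le> (\<Sum>t=1..T. (norm (x t - x' t))\<^sup>2)" by (intro sum_mono2) auto
    finally show "(\<Sum>t=1..<T. (norm (x t - x (Suc t)))\<^sup>2) \<le> (\<Sum>t=1..T. (norm (x t - x' t))\<^sup>2)" .
  qed (use \<open>0 < \<nu>\<close> in simp)
  ultimately show ?thesis unfolding a_def by linarith
qed

subsection \<open>Conditional laws given by a kernel\<close>

text \<open>Given the past \<open>F\<close>, the variable \<open>Y\<close> may be integrated out
  with the past frozen. The hypothesis \<open>cond\<close> holds outside a null set depending on
  \<open>B\<close>, so the argument compares measures: the joint law of the past and
  \<open>Y\<close> agrees with the law built from the kernel on all rectangles, an
  intersection-stable generator of the product.\<close>

lemma nn_integral_conditional_kernel: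
  fixes P F :: "'w measure" and S :: "'s measure"
  assumes "prob_space P" and sub: "subalgebra P F"
    and K: "K \<in> F \<rightarrow>\<^sub>M prob_algebra S" and Y: "Y \<in> P \<rightarrow>\<^sub>M S"
    and cond: "\<And>B. B \<in> sets S \<Longrightarrow>
      AE \<omega> in P. real_cond_exp P F (\<lambda>\<omega>'. indicator B (Y \<omega>')) \<omega> = measure (K \<omega>) B"
    and h: "(\<lambda>(\<omega>, y). h \<omega> y) \<in> borel_measurable (F \<Otimes>\<^sub>M S)"
  shows "(\<integral>\<^sup>+\<omega>. h \<omega> (Y \<omega>) \<partial>P) = (\<integral>\<^sup>+\<omega>. \<integral>\<^sup>+y. h \<omega> y \<partial>K \<omega> \<partial>P)"
proof -
  interpret prob_space P by fact
  interpret finite_measure_subalgebra P F using sub by unfold_locales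
  let ?R = "restr_to_subalg P F"
  have space_F: "space F = space P" using sub by (simp add: subalgebra_def)
  have K': "K \<in> F \<rightarrow>\<^sub>M subprob_algebra S" using K by (rule measurable_prob_algebraD)
  have KP: "K \<in> P \<rightarrow>\<^sub>M prob_algebra S" using measurable_from_subalg[OF sub K] .
  have K_space: "sets (K \<omega>) = sets S" "prob_space (K \<omega>)" if "\<omega> \<in> space P" for \<omega>
    using measurable_space[OF K] that by (auto simp: space_prob_algebra space_F)
  \<comment> \<open>\<open>N \<omega>\<close> places \<open>K \<omega>\<close> on the slice over
    \<open>\<omega>\<close>, so a function of both variables can be integrated by a single kernel
    into the product space.\<close>
  define N where "N \<omega> = distr (K \<omega>) (F \<Otimes>\<^sub>M S) (Pair \<omega>)" for \<omega>
  have N: "N \<in> F \<rightarrow>\<^sub>M subprob_algebra (F \<Otimes>\<^sub>M S)"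
    unfolding N_def by (rule measurable_distr2[OF _ K']) simp
  then have NR: "N \<in> ?R \<rightarrow>\<^sub>M subprob_algebra (F \<Otimes>\<^sub>M S)"
    by (rule measurable_in_subalg[OF sub])
  have Pair_K: "Pair \<omega> \<in> K \<omega> \<rightarrow>\<^sub>M F \<Otimes>\<^sub>M S" if "\<omega> \<in> space P" for \<omega>
    using that measurable_cong_sets[OF K_space(1)[OF that] refl, of "F \<Otimes>\<^sub>M S"]
    by (simp add: measurable_Pair1' space_F)
  have "(\<lambda>\<omega>. \<omega>) \<in> P \<rightarrow>\<^sub>M F" by (rule measurable_from_subalg[OF sub]) simp
  then have pair: "(\<lambda>\<omega>. (\<omega>, Y \<omega>)) \<in> P \<rightarrow>\<^sub>M F \<Otimes>\<^sub>M S"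
    using Y by simp
  have "distr P (F \<Otimes>\<^sub>M S) (\<lambda>\<omega>. (\<omega>, Y \<omega>)) = ?R \<bind> N"
  proof (rule measure_eqI_generator_eq[OF Int_stable_pair_measure_generator[of F S]])
    show "{a \<times> b |a b. a \<in> sets F \<and> b \<in> sets S} \<subseteq> Pow (space F \<times> space S)"
      by (rule pair_measure_closed)
    show "sets (distr P (F \<Otimes>\<^sub>M S) (\<lambda>\<omega>. (\<omega>, Y \<omega>)))
        = sigma_sets (space F \<times> space S) {a \<times> b |a b. a \<in> sets F \<and> b \<in> sets S}"
      by (simp add: sets_pair_measure)
    have ne: "space ?R \<noteq> {}" using not_empty by (simp add: space_restr_to_subalg)
    show "sets (?R \<bind> N) = sigma_sets (space F \<times> space S) {a \<times> b |a b. a \<in> sets F \<and> b \<in> sets S}"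
      using sets_bind[of ?R N "F \<Otimes>\<^sub>M S"] measurable_space[OF NR] ne
      by (auto simp: sets_pair_measure space_subprob_algebra)
    show "range (\<lambda>i::nat. space F \<times> space S) \<subseteq> {a \<times> b |a b. a \<in> sets F \<and> b \<in> sets S}"
      by blast
    show "(\<Union>i::nat. space F \<times> space S) = space F \<times> space S" by simp
    show "emeasure (distr P (F \<Otimes>\<^sub>M S) (\<lambda>\<omega>. (\<omega>, Y \<omega>))) (space F \<times> space S) \<noteq> \<infinity>"
      by (simp add: emeasure_distr[OF pair])
    fix Z assume "Z \<in> {a \<times> b |a b. a \<in> sets F \<and> b \<in> sets S}"
    then obtain A B where Z: "Z = A \<times> B" and A: "A \<in> sets F" and B: "B \<in> sets S" by blast
    have AP: "A \<in> sets P" using A sub by (auto simp: subalgebra_def)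
    have int: "integrable P (\<lambda>\<omega>. indicator B (Y \<omega>) :: real)"
      using Y B by (intro integrable_const_bound[of _ 1]) auto
    have meas: "(\<lambda>\<omega>. measure (K \<omega>) B) \<in> borel_measurable P"
      using KP B by simp
    have "emeasure (?R \<bind> N) Z = (\<integral>\<^sup>+\<omega>. emeasure (N \<omega>) Z \<partial>?R)"
      using A B Z by (intro emeasure_bind[OF ne NR]) auto
    also have "\<dots> = (\<integral>\<^sup>+\<omega>. emeasure (N \<omega>) Z \<partial>P)"
      using A B Z by (intro nn_integral_subalgebra2[OF sub] measurable_emeasure_kernel[OF N]) auto
    also have "\<dots> = (\<integral>\<^sup>+\<omega>. ennreal (indicator A \<omega> * measure (K \<omega>) B) \<partial>P)"
    proof (intro nn_integral_cong)
      fix \<omega> assume \<omega>: "\<omega> \<in> space P"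
      interpret K: prob_space "K \<omega>" by (rule K_space(2)[OF \<omega>])
      have "Pair \<omega> -` Z \<inter> space (K \<omega>) = (if \<omega> \<in> A then B else {})"
        using sets.sets_into_space[OF B] sets_eq_imp_space_eq[OF K_space(1)[OF \<omega>]] by (auto simp: Z)
      then show "emeasure (N \<omega>) Z = ennreal (indicator A \<omega> * measure (K \<omega>) B)"
        using A B by (simp add: N_def emeasure_distr[OF Pair_K[OF \<omega>]] Z K.emeasure_eq_measure)
    qed
    also have "\<dots> = ennreal (\<integral>\<omega>. indicator A \<omega> * measure (K \<omega>) B \<partial>P)"
    proof (intro nn_integral_eq_integral)
      show "integrable P (\<lambda>\<omega>. indicator A \<omega> * measure (K \<omega>) B)"
        using AP meas K_space(2)
        by (intro integrable_const_bound[of _ 1])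
           (auto simp: indicator_def intro!: AE_I2 prob_space.prob_le_1)
    qed simp
    \<comment> \<open>\<open>A\<close> belongs to \<open>F\<close>, so the defining property of the
      conditional expectation applies after this replacement.\<close>
    also have "(\<integral>\<omega>. indicator A \<omega> * measure (K \<omega>) B \<partial>P)
        = (\<integral>\<omega>\<in>A. real_cond_exp P F (\<lambda>\<omega>'. indicator B (Y \<omega>')) \<omega> \<partial>P)"
      unfolding set_lebesgue_integral_def
      using cond[OF B] AP meas by (intro integral_cong_AE) auto
    also have "\<dots> = (\<integral>\<omega>\<in>A. indicator B (Y \<omega>) \<partial>P)"
      by (rule real_cond_exp_intA[OF int A, symmetric])
    also have "\<dots> = measure P (A \<inter> (Y -` B \<inter> space P))"
    proof -
      have "(\<integral>\<omega>\<in>A. indicator B (Y \<omega>) \<partial>P) = (\<integral>\<omega>. indicator (A \<inter> (Y -` B \<inter> space P)) \<omega> \<partial>P)"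
        unfolding set_lebesgue_integral_def
        by (intro Bochner_Integration.integral_cong) (auto simp: indicator_def)
      also have "\<dots> = measure P (A \<inter> (Y -` B \<inter> space P))"
        using sets.sets_into_space[OF AP] by (simp add: Int_absorb2 Int_assoc)
      finally show ?thesis .
    qed
    also have "ennreal \<dots> = emeasure (distr P (F \<Otimes>\<^sub>M S) (\<lambda>\<omega>. (\<omega>, Y \<omega>))) Z"
    proof -
      have "(\<lambda>\<omega>. (\<omega>, Y \<omega>)) -` Z \<inter> space P = A \<inter> (Y -` B \<inter> space P)" by (auto simp: Z)
      then show ?thesis
        using A B by (simp add: emeasure_distr[OF pair] Z emeasure_eq_measure)
    qed
    finally show "emeasure (distr P (F \<Otimes>\<^sub>M S) (\<lambda>\<omega>. (\<omega>, Y \<omega>))) Z = emeasure (?R \<bind> N) Z" ..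
  qed
  note law = this
  have "(\<integral>\<^sup>+\<omega>. h \<omega> (Y \<omega>) \<partial>P) = (\<integral>\<^sup>+z. (\<lambda>(\<omega>, y). h \<omega> y) z \<partial>distr P (F \<Otimes>\<^sub>M S) (\<lambda>\<omega>. (\<omega>, Y \<omega>)))"
    using h by (simp add: nn_integral_distr[OF pair])
  also have "\<dots> = (\<integral>\<^sup>+\<omega>. \<integral>\<^sup>+z. (\<lambda>(\<omega>, y). h \<omega> y) z \<partial>N \<omega> \<partial>?R)"
    unfolding law by (rule nn_integral_bind[OF h NR])
  also have "\<dots> = (\<integral>\<^sup>+\<omega>. \<integral>\<^sup>+z. (\<lambda>(\<omega>, y). h \<omega> y) z \<partial>N \<omega> \<partial>P)"
    using measurable_compose[OF N nn_integral_measurable_subprob_algebra[OF h]]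
    by (rule nn_integral_subalgebra2[OF sub])
  also have "\<dots> = (\<integral>\<^sup>+\<omega>. \<integral>\<^sup>+y. h \<omega> y \<partial>K \<omega> \<partial>P)"
    using h by (intro nn_integral_cong) (simp add: N_def nn_integral_distr[OF Pair_K])
  finally show ?thesis .
qed

text \<open>An integrand that depends on the parameter is handled by pushing \<open>K x\<close>
  forward along \<open>Pair x\<close>: the result is a kernel into the product, against which the
  uncurried integrand is fixed.\<close>

lemma integral_measurable_subprob_algebra2:
  fixes h :: "'a \<Rightarrow> 'b \<Rightarrow> 'c::{banach, second_countable_topology}"
  assumes h: "(\<lambda>(x, y). h x y) \<in> borel_measurable (M \<Otimes>\<^sub>M N)"
    and K: "K \<in> M \<rightarrow>\<^sub>M subprob_algebra N"
  shows "(\<lambda>x. \<integral>y. h x y \<partial>K x) \<in> borel_measurable M"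
proof -
  have "(\<lambda>x. \<integral>z. (\<lambda>(x, y). h x y) z \<partial>distr (K x) (M \<Otimes>\<^sub>M N) (Pair x)) \<in> borel_measurable M"
    by (rule measurable_compose[OF measurable_distr2[OF _ K] integral_measurable_subprob_algebra[OF h]])
       simp
  moreover have "(\<integral>z. (\<lambda>(x, y). h x y) z \<partial>distr (K x) (M \<Otimes>\<^sub>M N) (Pair x)) = (\<integral>y. h x y \<partial>K x)"
    if "x \<in> space M" for x
  proof -
    have "sets (K x) = sets N"
      using measurable_space[OF K that] by (simp add: space_subprob_algebra)
    then have "Pair x \<in> K x \<rightarrow>\<^sub>M M \<Otimes>\<^sub>M N"
      using that measurable_cong_sets[of "K x" N] by (simp add: measurable_Pair1')
    then show ?thesis using h by (simp add: integral_distr)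
  qed
  ultimately show ?thesis by (simp cong: measurable_cong)
qed

section \<open>Jensen's inequality for the square root and two elementary inequalities\<close>

lemma (in prob_space) integral_sqrt_le:
  fixes Y :: "'a \<Rightarrow> real"
  assumes Y: "Y \<in> borel_measurable M" and nonneg: "\<And>\<omega>. 0 \<le> Y \<omega>" and bound: "AE \<omega> in M. Y \<omega> \<le> c"
    and Z: "(\<integral>\<^sup>+\<omega>. ennreal (Y \<omega>) \<partial>M) \<le> Z" "Z < \<infinity>"
  shows "integrable M (\<lambda>\<omega>. sqrt (Y \<omega>))" and "(\<integral>\<omega>. sqrt (Y \<omega>) \<partial>M) \<le> sqrt (enn2real Z)"
proof -
  have int: "integrable M Y"
    using Y bound nonneg by (intro integrable_const_bound[of _ c]) auto
  show int_sqrt: "integrable M (\<lambda>\<omega>. sqrt (Y \<omega>))"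
    using Y bound nonneg by (intro integrable_const_bound[of _ "sqrt c"]) auto
  \<comment> \<open>Jensen's inequality for the square root is the nonnegativity of the variance of
    \<open>sqrt (Y \<omega>)\<close>.\<close>
  have "0 \<le> variance (\<lambda>\<omega>. sqrt (Y \<omega>))" by (rule variance_positive)
  also have "\<dots> = expectation Y - (expectation (\<lambda>\<omega>. sqrt (Y \<omega>)))\<^sup>2"
    using int int_sqrt nonneg by (subst variance_eq) auto
  finally have "(expectation (\<lambda>\<omega>. sqrt (Y \<omega>)))\<^sup>2 \<le> expectation Y" by simp
  also have "\<dots> = enn2real (\<integral>\<^sup>+\<omega>. ennreal (Y \<omega>) \<partial>M)"
    using Y nonneg by (intro integral_eq_nn_integral) auto
  \<comment> \<open>Finiteness of \<open>Z\<close> matters: \<open>enn2real\<close> sends infinity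
    to 0.\<close>
  also have "\<dots> \<le> enn2real Z" using Z by (intro enn2real_mono) auto
  finally show "expectation (\<lambda>\<omega>. sqrt (Y \<omega>)) \<le> sqrt (enn2real Z)" by (rule real_le_rsqrt)
qed

lemma power2_norm_sum4_le:
  fixes a b c d :: "'a::real_normed_vector"
  shows "(norm (a + b + c + d))\<^sup>2 \<le> 4 * ((norm a)\<^sup>2 + (norm b)\<^sup>2 + (norm c)\<^sup>2 + (norm d)\<^sup>2)"
proof -
  have "norm (a + b + c + d) \<le> norm a + norm b + norm c + norm d"
    by (intro norm_triangle_le add_mono order_refl)
  then have "(norm (a + b + c + d))\<^sup>2 \<le> (norm a + norm b + norm c + norm d)\<^sup>2"
    by (rule power_mono) simp
  also have "\<dots> \<le> 4 * ((norm a)\<^sup>2 + (norm b)\<^sup>2 + (norm c)\<^sup>2 + (norm d)\<^sup>2)"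
    using sum_squared_le_sum_of_squares[of "\<lambda>i. [norm a, norm b, norm c, norm d] ! i" "{..<4::nat}"]
    by (simp add: numeral_eq_Suc algebra_simps)
  finally show ?thesis .
qed

text \<open>Used to absorb the Lipschitz contribution, linear in the total movement \<open>r\<close>
  of the iterates, into the negative quadratic movement term.\<close>

lemma linear_minus_quadratic_le:
  fixes b c r :: real
  assumes "0 < c"
  shows "b * r - c * r\<^sup>2 \<le> b\<^sup>2 / (4 * c)"
proof -
  have "0 \<le> (2 * c * r - b)\<^sup>2 / (4 * c)" using assms by simp
  also have "\<dots> = c * r\<^sup>2 - b * r + b\<^sup>2 / (4 * c)"
    using assms by (simp add: field_simps power2_eq_square)
  finally show ?thesis by simp
qed

subsection \<open>The stochastically extended adversarial model\<close>

text \<open>The setting common to all bounds. Smoothness is added lemma by lemma, so that the almost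
  sure bound can share the setting. The diameter is positive here since \<open>D\<^sup>2\<close>
  occurs in denominators; diameter zero is treated in the final theorem.\<close>

locale sea_oftrl = prob_space P for P :: "'w measure" +
  fixes X :: "(real^'d) set" and S :: "'xi measure" and \<DD> :: "'xi measure set"
    and df :: "real^'d \<Rightarrow> 'xi \<Rightarrow> real^'d"
    and T :: nat and \<F> :: "nat \<Rightarrow> 'w measure"
    and \<D> :: "nat \<Rightarrow> 'w \<Rightarrow> 'xi measure" and \<xi> :: "nat \<Rightarrow> 'w \<Rightarrow> 'xi"
    and x g M :: "nat \<Rightarrow> 'w \<Rightarrow> real^'d" and \<eta> :: "nat \<Rightarrow> 'w \<Rightarrow> real"
    and D G \<nu> :: real
  assumes X: "closed X" "bounded X" "convex X"
    and D_eq: "D = diameter X" and D_pos: "0 < D" and norm_le_D: "\<forall>y\<in>X. norm y \<le> D"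
    and \<DD>: "\<DD> \<subseteq> space (prob_algebra S)"
    and df: "(\<lambda>(x, \<xi>). df x \<xi>) \<in> borel_measurable (restrict_space borel X \<Otimes>\<^sub>M S)"
    and T_ge: "T \<ge> 1"
    and protocol: "sea_protocol S \<DD> T P \<F> \<D> \<xi>"
    and g_eq: "g t \<omega> = df (x t \<omega>) (\<xi> t \<omega>)"
    and M_eq: "M t \<omega> = (if t = 1 then 0 else g (t - 1) \<omega>)"
    and \<nu>_pos: "\<nu> > 0"
    and step: "\<omega> \<in> space P \<Longrightarrow> adaptive_step D \<nu> T (\<lambda>t. M t \<omega>) (\<lambda>t. g t \<omega>) (\<lambda>t. \<eta> t \<omega>)"
    and oftrl: "\<omega> \<in> space P \<Longrightarrow>
      oftrl X T (\<lambda>t. \<eta> t \<omega>) (\<lambda>t. M t \<omega>) (\<lambda>t. g t \<omega>) (\<lambda>t. x t \<omega>)"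
    and bounded_grad: "K \<in> \<DD> \<Longrightarrow> AE \<xi> in K. \<forall>y\<in>X. norm (df y \<xi>) \<le> G"
begin

section \<open>Filtration and predictability of the learner\<close>

lemma subalgebra_\<F>: "t \<le> T \<Longrightarrow> subalgebra P (\<F> t)"
  using protocol by (auto simp: sea_protocol_def)

lemma space_\<F>: "t \<le> T \<Longrightarrow> space (\<F> t) = space P"
  using subalgebra_\<F> by (auto simp: subalgebra_def)

lemma subalgebra_mono:
  assumes "s \<le> t" "t \<le> T"
  shows "subalgebra (\<F> t) (\<F> s)"
  using assms
proof (induction t rule: dec_induct)
  case (step n)
  then have "subalgebra (\<F> (Suc n)) (\<F> n)"
    using protocol by (auto simp: sea_protocol_def dest!: bspec[of _ _ "Suc n"])
  then show ?case using step by (auto simp: subalgebra_def)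
qed (simp add: subalgebra_def)

lemma measurable_mono: "f \<in> \<F> s \<rightarrow>\<^sub>M N \<Longrightarrow> s \<le> t \<Longrightarrow> t \<le> T \<Longrightarrow> f \<in> \<F> t \<rightarrow>\<^sub>M N"
  using measurable_from_subalg[OF subalgebra_mono] by blast

lemma measurable_P: "f \<in> \<F> t \<rightarrow>\<^sub>M N \<Longrightarrow> t \<le> T \<Longrightarrow> f \<in> P \<rightarrow>\<^sub>M N"
  using measurable_from_subalg[OF subalgebra_\<F>] by blast

lemma
  assumes "t \<in> {1..T}"
  shows measurable_\<D>: "\<D> t \<in> \<F> (t - 1) \<rightarrow>\<^sub>M prob_algebra S"
    and \<D>_in: "\<omega> \<in> space P \<Longrightarrow> \<D> t \<omega> \<in> \<DD>"
    and measurable_\<xi>: "\<xi> t \<in> \<F> t \<rightarrow>\<^sub>M S"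
    and cond_\<xi>: "A \<in> sets S \<Longrightarrow> AE \<omega> in P.
      real_cond_exp P (\<F> (t - 1)) (\<lambda>\<omega>'. indicator A (\<xi> t \<omega>')) \<omega> = measure (\<D> t \<omega>) A"
  using protocol assms by (auto simp: sea_protocol_def)

lemma x_in: "t \<in> {1..T} \<Longrightarrow> \<omega> \<in> space P \<Longrightarrow> x t \<omega> \<in> X"
  using oftrl by (auto simp: oftrl_def is_arg_min_def)

lemma X_nonempty: "X \<noteq> {}"
  using not_empty x_in[of 1] T_ge by fastforce

lemma \<eta>_pos: "t \<in> {1..T} \<Longrightarrow> \<omega> \<in> space P \<Longrightarrow> 0 < \<eta> t \<omega>"
  using adaptive_step_pos[OF D_pos \<nu>_pos step] by blast

text \<open>Strong induction along the recursion of the algorithm: step size and iterate of round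
  \<open>t\<close> are built from earlier gradients, whereas \<open>g t\<close> also involves the
  sample of round \<open>t\<close> and is therefore only known one index later.\<close>

lemma measurable_learner:
  assumes "t \<in> {1..T}"
  shows "x t \<in> \<F> (t - 1) \<rightarrow>\<^sub>M restrict_space borel X \<and> \<eta> t \<in> borel_measurable (\<F> (t - 1)) \<and>
    g t \<in> borel_measurable (\<F> t)"
  using assms
proof (induction t rule: less_induct)
  case (less t)
  have t: "t - 1 \<le> T" "1 \<le> t" "t \<le> T" using less.prems by auto
  note space_t = space_\<F>[OF t(1)]
  have g: "g s \<in> borel_measurable (\<F> (t - 1))"
    and \<eta>: "\<eta> s \<in> borel_measurable (\<F> (t - 1))" if "s \<in> {1..<t}" for s
  proof -
    have "s < t" "s \<in> {1..T}" and s: "s \<le> t - 1" "s - 1 \<le> t - 1" using that t by auto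
    note IH = less.IH[OF this(1,2)]
    show "g s \<in> borel_measurable (\<F> (t - 1))" using IH s(1) t(1) by (blast intro: measurable_mono)
    show "\<eta> s \<in> borel_measurable (\<F> (t - 1))" using IH s(2) t(1) by (blast intro: measurable_mono)
  qed
  \<comment> \<open>The range includes \<open>s = t\<close>: the prediction of the current round is
    the previous gradient and already known.\<close>
  have M: "M s \<in> borel_measurable (\<F> (t - 1))" if "s \<in> {1..t}" for s
  proof (cases "s = 1")
    case True then show ?thesis by (simp add: M_eq[abs_def])
  next
    case False
    then have "s - 1 \<in> {1..<t}" using that by auto
    from g[OF this] show ?thesis using False by (simp add: M_eq[abs_def])
  qed
  have "(\<lambda>\<omega>. \<eta> s \<omega> * (norm (g s \<omega> - M s \<omega>))\<^sup>2) \<in> borel_measurable (\<F> (t - 1))"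
    if "s \<in> {1..<t}" for s
    using g[OF that] \<eta>[OF that] M[of s] that by simp
  then have "(\<lambda>\<omega>. D\<^sup>2 / (\<nu> + (\<Sum>s=1..<t. \<eta> s \<omega> * (norm (g s \<omega> - M s \<omega>))\<^sup>2)))
      \<in> borel_measurable (\<F> (t - 1))"
    by (intro borel_measurable_divide borel_measurable_add borel_measurable_sum borel_measurable_const)
  then have \<eta>_t: "\<eta> t \<in> borel_measurable (\<F> (t - 1))"
    using step less.prems t
    by (subst measurable_cong[of "\<F> (t - 1)"]) (auto simp: space_\<F> adaptive_step_def)
  have "(\<lambda>\<omega>. - (\<eta> t \<omega> / 2) *\<^sub>R (M t \<omega> + (\<Sum>s=1..<t. g s \<omega>))) \<in> borel_measurable (\<F> (t - 1))"
    using \<eta>_t g M[of t] t by (intro borel_measurable_scaleR borel_measurable_add borel_measurable_sum) auto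
  \<comment> \<open>The projection onto a closed convex set is continuous, so the minimiser depends
    measurably on the data.\<close>
  moreover have "closest_point X \<in> borel_measurable borel"
    by (intro borel_measurable_continuous_onI continuous_on_closest_point X X_nonempty)
  ultimately have "(\<lambda>\<omega>. closest_point X (- (\<eta> t \<omega> / 2) *\<^sub>R (M t \<omega> + (\<Sum>s=1..<t. g s \<omega>))))
      \<in> borel_measurable (\<F> (t - 1))"
    by (rule measurable_compose)
  moreover have "x t \<omega> = closest_point X (- (\<eta> t \<omega> / 2) *\<^sub>R (M t \<omega> + (\<Sum>s=1..<t. g s \<omega>)))"
    if "\<omega> \<in> space P" for \<omega>
    using oftrl[OF that] less.prems
    by (intro argmin_eq_closest_point[OF X(1,3) \<eta>_pos[OF less.prems that]]) (auto simp: oftrl_def)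
  ultimately have "x t \<in> borel_measurable (\<F> (t - 1))"
    by (subst measurable_cong) (simp_all only: space_t)
  then have x_t: "x t \<in> \<F> (t - 1) \<rightarrow>\<^sub>M restrict_space borel X"
    using x_in[OF less.prems] unfolding measurable_restrict_space2_iff space_t by blast
  then have "x t \<in> \<F> t \<rightarrow>\<^sub>M restrict_space borel X"
    by (rule measurable_mono) (use t in auto)
  then have "(\<lambda>\<omega>. (x t \<omega>, \<xi> t \<omega>)) \<in> \<F> t \<rightarrow>\<^sub>M restrict_space borel X \<Otimes>\<^sub>M S"
    using measurable_\<xi>[OF less.prems] by simp
  from measurable_compose[OF this df] have "g t \<in> borel_measurable (\<F> t)"
    by (simp add: g_eq[abs_def])
  with x_t \<eta>_t show ?case by blast
qed

lemma
  assumes "t \<in> {1..T}"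
  shows measurable_x: "x t \<in> \<F> (t - 1) \<rightarrow>\<^sub>M restrict_space borel X"
    and measurable_x_P: "x t \<in> P \<rightarrow>\<^sub>M restrict_space borel X"
    and measurable_g_P: "g t \<in> borel_measurable P"
    and measurable_\<D>_P: "\<D> t \<in> P \<rightarrow>\<^sub>M prob_algebra S"
proof -
  have t: "t - 1 \<le> T" "t \<le> T" using assms by auto
  note * = measurable_learner[OF assms] measurable_\<D>[OF assms]
  then show "x t \<in> \<F> (t - 1) \<rightarrow>\<^sub>M restrict_space borel X" by blast
  then show "x t \<in> P \<rightarrow>\<^sub>M restrict_space borel X" by (rule measurable_P) fact
  show "g t \<in> borel_measurable P" using * t by (blast intro: measurable_P)
  show "\<D> t \<in> P \<rightarrow>\<^sub>M prob_algebra S" using * t by (blast intro: measurable_P)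
qed

lemma measurable_df_comp:
  assumes "y \<in> N \<rightarrow>\<^sub>M restrict_space borel X"
  shows "(\<lambda>(\<omega>, z). df (y \<omega>) z) \<in> borel_measurable (N \<Otimes>\<^sub>M S)"
proof -
  have "(\<lambda>p. (y (fst p), snd p)) \<in> N \<Otimes>\<^sub>M S \<rightarrow>\<^sub>M restrict_space borel X \<Otimes>\<^sub>M S"
    using measurable_compose[OF measurable_fst[of N S] assms] by simp
  from measurable_compose[OF this df] show ?thesis by (simp add: case_prod_beta)
qed

lemma measurable_mean_grad:
  assumes "K \<in> N \<rightarrow>\<^sub>M prob_algebra S" "y \<in> N \<rightarrow>\<^sub>M restrict_space borel X"
  shows "(\<lambda>\<omega>. mean_grad df (K \<omega>) (y \<omega>)) \<in> borel_measurable N"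
  unfolding mean_grad_def
  by (intro integral_measurable_subprob_algebra2[where N = S] measurable_df_comp assms
      measurable_prob_algebraD)

lemma measurable_grad_variance:
  assumes "K \<in> N \<rightarrow>\<^sub>M prob_algebra S" "y \<in> N \<rightarrow>\<^sub>M restrict_space borel X"
  shows "(\<lambda>\<omega>. grad_variance df (K \<omega>) (y \<omega>)) \<in> borel_measurable N"
  unfolding grad_variance_def
proof (intro integral_measurable_subprob_algebra2[where N = S] measurable_prob_algebraD assms)
  have "(\<lambda>p. mean_grad df (K (fst p)) (y (fst p))) \<in> borel_measurable (N \<Otimes>\<^sub>M S)"
    using measurable_mean_grad[OF assms] by simp
  then show "(\<lambda>(\<omega>, z). (norm (df (y \<omega>) z - mean_grad df (K \<omega>) (y \<omega>)))\<^sup>2) \<in> borel_measurable (N \<Otimes>\<^sub>M S)"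
    using measurable_df_comp[OF assms(2)] by (simp add: case_prod_beta)
qed

section \<open>Uniform bounds on mean gradients, variances and shifts\<close>

lemma
  assumes "K \<in> \<DD>"
  shows \<DD>_prob: "prob_space K" and \<DD>_sets: "sets K = sets S"
  using \<DD> assms by (auto simp: space_prob_algebra)

lemma
  assumes "K \<in> \<DD>" "y \<in> X"
  shows norm_mean_grad_le: "norm (mean_grad df K y) \<le> G"
    and grad_variance_nonneg: "0 \<le> grad_variance df K y"
    and grad_variance_le: "grad_variance df K y \<le> 4 * G\<^sup>2"
    and integrable_deviation: "integrable K (\<lambda>z. (norm (df y z - mean_grad df K y))\<^sup>2)"
proof -
  interpret K: prob_space K by (rule \<DD>_prob[OF \<open>K \<in> \<DD>\<close>])
  have "y \<in> space (restrict_space borel X)" using \<open>y \<in> X\<close> by (simp add: space_restrict_space)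
  from measurable_compose[OF measurable_Pair1'[OF this] df]
  have df_y: "df y \<in> borel_measurable K"
    by (subst measurable_cong_sets[OF \<DD>_sets[OF \<open>K \<in> \<DD>\<close>] refl]) simp
  have bound: "AE z in K. norm (df y z) \<le> G"
    using bounded_grad[OF \<open>K \<in> \<DD>\<close>] by eventually_elim (use \<open>y \<in> X\<close> in auto)
  have int: "integrable K (df y)" by (rule K.integrable_const_bound[OF bound df_y])
  have "norm (mean_grad df K y) \<le> (\<integral>z. norm (df y z) \<partial>K)"
    unfolding mean_grad_def by (rule integral_norm_bound)
  also have "\<dots> \<le> G" using int bound by (intro K.integral_le_const) auto
  finally show mean: "norm (mean_grad df K y) \<le> G" .
  have dev: "AE z in K. (norm (df y z - mean_grad df K y))\<^sup>2 \<le> 4 * G\<^sup>2"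
    using bound
  proof eventually_elim
    case (elim z)
    have "norm (df y z - mean_grad df K y) \<le> 2 * G"
      using norm_triangle_ineq4[of "df y z" "mean_grad df K y"] elim mean by linarith
    then have "(norm (df y z - mean_grad df K y))\<^sup>2 \<le> (2 * G)\<^sup>2" by (rule power_mono) simp
    then show ?case by (simp add: power_mult_distrib)
  qed
  show int2: "integrable K (\<lambda>z. (norm (df y z - mean_grad df K y))\<^sup>2)"
    using dev df_y by (intro K.integrable_const_bound[of _ "4 * G\<^sup>2"]) auto
  show "0 \<le> grad_variance df K y" by (simp add: grad_variance_def)
  show "grad_variance df K y \<le> 4 * G\<^sup>2"
    unfolding grad_variance_def by (rule K.integral_le_const[OF int2 dev])
qed

text \<open>The uniform bound \<open>4 * G\<^sup>2\<close> gives the boundedness above without which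
  a real-valued \<open>SUP\<close> says nothing about its members. The same holds for
  \<open>grad_shift\<close> below.\<close>

lemma
  assumes "K \<in> \<DD>"
  shows grad_variance_le_max: "y \<in> X \<Longrightarrow> grad_variance df K y \<le> max_variance X df K"
    and max_variance_le: "max_variance X df K \<le> 4 * G\<^sup>2"
  unfolding max_variance_def using grad_variance_le[OF assms] X_nonempty
  by (auto intro!: cSUP_upper cSUP_least bdd_aboveI2)

lemma norm_mean_grad_diff_le:
  assumes "K \<in> \<DD>" "K' \<in> \<DD>" "y \<in> X"
  shows "(norm (mean_grad df K y - mean_grad df K' y))\<^sup>2 \<le> 4 * G\<^sup>2"
proof -
  have "norm (mean_grad df K y - mean_grad df K' y) \<le> 2 * G"
    using norm_triangle_ineq4[of "mean_grad df K y" "mean_grad df K' y"] assms norm_mean_grad_le[of K y]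
      norm_mean_grad_le[of K' y] by linarith
  then have "(norm (mean_grad df K y - mean_grad df K' y))\<^sup>2 \<le> (2 * G)\<^sup>2" by (rule power_mono) simp
  then show ?thesis by (simp add: power_mult_distrib)
qed

lemma
  assumes "K \<in> \<DD>" "K' \<in> \<DD>"
  shows norm_mean_grad_diff_le_shift:
      "y \<in> X \<Longrightarrow> (norm (mean_grad df K y - mean_grad df K' y))\<^sup>2 \<le> grad_shift X df K K'"
    and grad_shift_le: "grad_shift X df K K' \<le> 4 * G\<^sup>2"
    and grad_shift_nonneg: "0 \<le> grad_shift X df K K'"
proof -
  show le: "(norm (mean_grad df K y - mean_grad df K' y))\<^sup>2 \<le> grad_shift X df K K'" if "y \<in> X" for y
    unfolding grad_shift_def using norm_mean_grad_diff_le[OF assms] that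
    by (intro cSUP_upper bdd_aboveI2) auto
  show "grad_shift X df K K' \<le> 4 * G\<^sup>2"
    unfolding grad_shift_def using norm_mean_grad_diff_le[OF assms] X_nonempty by (intro cSUP_least) auto
  obtain y where "y \<in> X" using X_nonempty by blast
  from order_trans[OF zero_le_power2 le[OF this]] show "0 \<le> grad_shift X df K K'" .
qed

lemma G_nonneg: "0 \<le> G"
proof -
  obtain \<omega> where "\<omega> \<in> space P" using not_empty by blast
  then show ?thesis
    using order_trans[OF norm_ge_zero norm_mean_grad_le[OF \<D>_in x_in]] T_ge by force
qed

text \<open>Both \<open>x t\<close> and \<open>\<D> t\<close> are known at time
  \<open>t - 1\<close>, so this covers every nonnegative measurable function of them and of the
  fresh sample.\<close>

lemma nn_integral_\<xi>:
  assumes t: "t \<in> {1..T}" and "(\<lambda>(\<omega>, y). h \<omega> y) \<in> borel_measurable (\<F> (t - 1) \<Otimes>\<^sub>M S)"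
  shows "(\<integral>\<^sup>+\<omega>. h \<omega> (\<xi> t \<omega>) \<partial>P) = (\<integral>\<^sup>+\<omega>. \<integral>\<^sup>+y. h \<omega> y \<partial>\<D> t \<omega> \<partial>P)"
  using t cond_\<xi>[OF t] measurable_\<D>[OF t] assms(2) measurable_P[OF measurable_\<xi>[OF t]]
  by (intro nn_integral_conditional_kernel[of P "\<F> (t - 1)" _ S] prob_space_axioms subalgebra_\<F>) auto

text \<open>The gradient bound is given almost surely under each fixed distribution, whereas
  \<open>\<D> t\<close> is random. Integrating the indicator of a violation through the kernel
  transfers the bound to \<open>P\<close>.\<close>

lemma AE_norm_g_le:
  assumes t: "t \<in> {1..T}"
  shows "AE \<omega> in P. norm (g t \<omega>) \<le> G"
proof -
  define h :: "'w \<Rightarrow> 'xi \<Rightarrow> ennreal" where "h \<omega> y = indicator {G<..} (norm (df (x t \<omega>) y))" for \<omega> y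
  have h: "(\<lambda>(\<omega>, y). h \<omega> y) \<in> borel_measurable (\<F> (t - 1) \<Otimes>\<^sub>M S)"
    using measurable_df_comp[OF measurable_x[OF t]] unfolding h_def case_prod_beta by measurable
  have "(\<integral>\<^sup>+\<omega>. h \<omega> (\<xi> t \<omega>) \<partial>P) = (\<integral>\<^sup>+\<omega>. \<integral>\<^sup>+y. h \<omega> y \<partial>\<D> t \<omega> \<partial>P)"
    by (rule nn_integral_\<xi>[OF t h])
  also have "\<dots> = (\<integral>\<^sup>+\<omega>. 0 \<partial>P)"
  proof (intro nn_integral_cong)
    fix \<omega> assume \<omega>: "\<omega> \<in> space P"
    have "AE y in \<D> t \<omega>. h \<omega> y = 0"
      using bounded_grad[OF \<D>_in[OF t \<omega>]]
      by eventually_elim (use x_in[OF t \<omega>] in \<open>auto simp: h_def\<close>)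
    then have "(\<integral>\<^sup>+y. h \<omega> y \<partial>\<D> t \<omega>) = (\<integral>\<^sup>+y. 0 \<partial>\<D> t \<omega>)" by (rule nn_integral_cong_AE)
    then show "(\<integral>\<^sup>+y. h \<omega> y \<partial>\<D> t \<omega>) = 0" by simp
  qed
  finally have "(\<integral>\<^sup>+\<omega>. indicator {G<..} (norm (g t \<omega>)) \<partial>P) = 0" by (simp add: h_def g_eq)
  then have "AE \<omega> in P. (indicator {G<..} (norm (g t \<omega>)) :: ennreal) = 0"
    using measurable_g_P[OF t] by (subst (asm) nn_integral_0_iff_AE) auto
  then show ?thesis by eventually_elim (auto simp: indicator_def split: if_splits)
qed

text \<open>With the past frozen, the inner integral of the squared sampling error is the variance
  at the current iterate by definition.\<close>

lemma nn_integral_noise: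
  assumes t: "t \<in> {1..T}"
  shows "(\<integral>\<^sup>+\<omega>. ennreal ((norm (g t \<omega> - mean_grad df (\<D> t \<omega>) (x t \<omega>)))\<^sup>2) \<partial>P)
    = (\<integral>\<^sup>+\<omega>. ennreal (grad_variance df (\<D> t \<omega>) (x t \<omega>)) \<partial>P)"
proof -
  let ?h = "\<lambda>\<omega> y. ennreal ((norm (df (x t \<omega>) y - mean_grad df (\<D> t \<omega>) (x t \<omega>)))\<^sup>2)"
  have "(\<lambda>p. mean_grad df (\<D> t (fst p)) (x t (fst p))) \<in> borel_measurable (\<F> (t - 1) \<Otimes>\<^sub>M S)"
    using measurable_mean_grad[OF measurable_\<D>[OF t] measurable_x[OF t]] by simp
  then have h: "(\<lambda>(\<omega>, y). ?h \<omega> y) \<in> borel_measurable (\<F> (t - 1) \<Otimes>\<^sub>M S)"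
    using measurable_df_comp[OF measurable_x[OF t]] by (simp add: case_prod_beta)
  have "(\<integral>\<^sup>+\<omega>. ?h \<omega> (\<xi> t \<omega>) \<partial>P) = (\<integral>\<^sup>+\<omega>. \<integral>\<^sup>+y. ?h \<omega> y \<partial>\<D> t \<omega> \<partial>P)"
    by (rule nn_integral_\<xi>[OF t h])
  also have "\<dots> = (\<integral>\<^sup>+\<omega>. ennreal (grad_variance df (\<D> t \<omega>) (x t \<omega>)) \<partial>P)"
    unfolding grad_variance_def using integrable_deviation[OF \<D>_in[OF t] x_in[OF t]]
    by (intro nn_integral_cong nn_integral_eq_integral) auto
  finally show ?thesis by (simp add: g_eq)
qed

subsection \<open>Regret along a path and in expectation\<close>

lemma norm_g_diff_le:
  assumes "\<forall>t\<in>{1..T}. norm (g t \<omega>) \<le> G" "t \<in> {1..T}"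
  shows "(norm (g t \<omega> - M t \<omega>))\<^sup>2 \<le> 4 * G\<^sup>2"
proof -
  have "t = 1 \<or> t - 1 \<in> {1..T}" using assms(2) by auto
  then have "norm (M t \<omega>) \<le> G" using assms(1) G_nonneg by (auto simp: M_eq)
  then have "norm (g t \<omega> - M t \<omega>) \<le> 2 * G"
    using norm_triangle_ineq4[of "g t \<omega>" "M t \<omega>"] assms bspec[OF assms] by linarith
  then have "(norm (g t \<omega> - M t \<omega>))\<^sup>2 \<le> (2 * G)\<^sup>2" by (rule power_mono) simp
  then show ?thesis by (simp add: power_mult_distrib)
qed

lemma path_regret_le:
  assumes "\<omega> \<in> space P" "\<forall>t\<in>{1..T}. norm (g t \<omega>) \<le> G" "u \<in> X"
  shows "regret T (\<lambda>t. g t \<omega>) (\<lambda>t. x t \<omega>) u \<le> \<nu> + 4 * D\<^sup>2 * G\<^sup>2 / \<nu>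
      + 3 / 2 * sqrt 2 * D * sqrt (\<Sum>t=1..T. (norm (g t \<omega> - M t \<omega>))\<^sup>2)
      - \<nu> / (2 * D\<^sup>2) * (\<Sum>t=1..<T. (norm (x t \<omega> - x (Suc t) \<omega>))\<^sup>2)"
  using oftrl_adaptive_regret_le[OF X(1,3,2) D_eq D_pos norm_le_D T_ge \<open>u \<in> X\<close> \<nu>_pos _
      step[OF assms(1)] oftrl[OF assms(1)] norm_g_diff_le[OF assms(2)]]
  by (simp add: M_eq mult_ac)

lemma AE_norms_g_le: "AE \<omega> in P. \<forall>t\<in>{1..T}. norm (g t \<omega>) \<le> G"
  by (intro AE_finite_allI AE_norm_g_le) auto

text \<open>The choice \<open>\<nu> = 2 * D * G\<close> minimises
  \<open>\<nu> + 4 * D\<^sup>2 * G\<^sup>2 / \<nu>\<close>; the two summands are then equal and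
  together give \<open>4 * D * G\<close>.\<close>

lemma AE_regret_le:
  assumes "\<nu> = 2 * D * G"
  shows "AE \<omega> in P. \<forall>u\<in>X. regret T (\<lambda>t. g t \<omega>) (\<lambda>t. x t \<omega>) u
    \<le> 3 * sqrt 2 * D * G * sqrt (real T) + 4 * D * G"
  using AE_norms_g_le AE_space
proof eventually_elim
  case (elim \<omega>)
  show ?case
  proof
    fix u assume "u \<in> X"
    have "0 < D * G" using assms \<nu>_pos by simp
    have "(\<Sum>t=1..T. (norm (g t \<omega> - M t \<omega>))\<^sup>2) \<le> (\<Sum>t=1..T. 4 * G\<^sup>2)"
      by (intro sum_mono norm_g_diff_le elim)
    then have "sqrt (\<Sum>t=1..T. (norm (g t \<omega> - M t \<omega>))\<^sup>2) \<le> sqrt ((2 * G)\<^sup>2 * real T)"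
      by (simp add: power_mult_distrib mult_ac)
    also have "\<dots> = 2 * G * sqrt (real T)" using G_nonneg by (simp add: real_sqrt_mult)
    finally have "3 / 2 * sqrt 2 * D * sqrt (\<Sum>t=1..T. (norm (g t \<omega> - M t \<omega>))\<^sup>2)
        \<le> 3 / 2 * sqrt 2 * D * (2 * G * sqrt (real T))"
      using D_pos by (intro mult_left_mono) auto
    moreover have "0 \<le> \<nu> / (2 * D\<^sup>2) * (\<Sum>t=1..<T. (norm (x t \<omega> - x (Suc t) \<omega>))\<^sup>2)"
      using \<nu>_pos by (simp add: sum_nonneg)
    moreover have "4 * D\<^sup>2 * G\<^sup>2 / \<nu> = 2 * D * G"
      using \<open>0 < D * G\<close> assms by (simp add: power2_eq_square)
    ultimately show "regret T (\<lambda>t. g t \<omega>) (\<lambda>t. x t \<omega>) u \<le> 3 * sqrt 2 * D * G * sqrt (real T) + 4 * D * G"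
      using path_regret_le[OF elim(2,1) \<open>u \<in> X\<close>] assms by (simp add: mult_ac)
  qed
qed

section \<open>Splitting the gradient variation into noise, drift and movement\<close>

definition noise :: "nat \<Rightarrow> 'w \<Rightarrow> real" where
  "noise t \<omega> = (norm (g t \<omega> - mean_grad df (\<D> t \<omega>) (x t \<omega>)))\<^sup>2"

text \<open>Indexed by the earlier of two consecutive rounds. Both mean gradients are taken at the
  newer iterate, so that the remaining difference involves one distribution at two points and falls
  under the Lipschitz condition.\<close>

definition drift :: "nat \<Rightarrow> 'w \<Rightarrow> real" where
  "drift t \<omega> = (norm (mean_grad df (\<D> (Suc t) \<omega>) (x (Suc t) \<omega>) - mean_grad df (\<D> t \<omega>) (x (Suc t) \<omega>)))\<^sup>2"

lemma noise_nonneg: "0 \<le> noise t \<omega>" and drift_nonneg: "0 \<le> drift t \<omega>"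
  by (simp_all add: noise_def drift_def)

text \<open>Squaring a sum of four terms costs a factor 4. The sampling error of a round can enter
  two consecutive differences, hence the factor 8.\<close>

lemma path_variation_le:
  assumes "\<omega> \<in> space P" "\<forall>t\<in>{1..T}. norm (g t \<omega>) \<le> G"
    and L: "\<forall>K\<in>\<DD>. L-lipschitz_on X (mean_grad df K)"
  shows "(\<Sum>t=1..T. (norm (g t \<omega> - M t \<omega>))\<^sup>2) \<le> G\<^sup>2 + 8 * (\<Sum>t=1..T. noise t \<omega>)
    + 4 * (\<Sum>t=1..<T. drift t \<omega>) + 4 * L\<^sup>2 * (\<Sum>t=1..<T. (norm (x t \<omega> - x (Suc t) \<omega>))\<^sup>2)"
proof -
  have split: "(norm (g (Suc t) \<omega> - M (Suc t) \<omega>))\<^sup>2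
      \<le> 4 * noise (Suc t) \<omega> + 4 * noise t \<omega> + 4 * drift t \<omega> + 4 * L\<^sup>2 * (norm (x t \<omega> - x (Suc t) \<omega>))\<^sup>2"
    if t: "t \<in> {1..<T}" for t
  proof -
    let ?F = "\<lambda>t y. mean_grad df (\<D> t \<omega>) y"
    have "norm (?F t (x (Suc t) \<omega>) - ?F t (x t \<omega>)) \<le> L * norm (x t \<omega> - x (Suc t) \<omega>)"
      using lipschitz_onD[OF bspec[OF L \<D>_in[of t \<omega>]] x_in[of "Suc t" \<omega>] x_in[of t \<omega>]] t assms(1)
      by (simp add: dist_norm norm_minus_commute)
    then have "(norm (?F t (x (Suc t) \<omega>) - ?F t (x t \<omega>)))\<^sup>2 \<le> (L * norm (x t \<omega> - x (Suc t) \<omega>))\<^sup>2"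
      by (rule power_mono) simp
    \<comment> \<open>In order: new sampling error, negated old sampling error, change of
      distribution at the new iterate, change of iterate under the old distribution.\<close>
    moreover have "g (Suc t) \<omega> - M (Suc t) \<omega> = (g (Suc t) \<omega> - ?F (Suc t) (x (Suc t) \<omega>))
        + (?F t (x t \<omega>) - g t \<omega>) + (?F (Suc t) (x (Suc t) \<omega>) - ?F t (x (Suc t) \<omega>))
        + (?F t (x (Suc t) \<omega>) - ?F t (x t \<omega>))"
      using t by (simp add: M_eq)
    ultimately show ?thesis
      using power2_norm_sum4_le[of "g (Suc t) \<omega> - ?F (Suc t) (x (Suc t) \<omega>)" "?F t (x t \<omega>) - g t \<omega>"
          "?F (Suc t) (x (Suc t) \<omega>) - ?F t (x (Suc t) \<omega>)" "?F t (x (Suc t) \<omega>) - ?F t (x t \<omega>)"]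
      by (simp add: noise_def drift_def norm_minus_commute power_mult_distrib)
  qed
  have decomp: "(\<Sum>t=1..T. c t) = c 1 + (\<Sum>t=1..<T. c (Suc t))"
    "(\<Sum>t=1..T. c t) = (\<Sum>t=1..<T. c t) + c T" for c :: "nat \<Rightarrow> real"
  proof -
    obtain n where "T = Suc n" using T_ge by (cases T) auto
    then show "(\<Sum>t=1..T. c t) = c 1 + (\<Sum>t=1..<T. c (Suc t))" "(\<Sum>t=1..T. c t) = (\<Sum>t=1..<T. c t) + c T"
      using sum.atLeast_Suc_atMost[of 1 T c] sum.shift_bounds_cl_Suc_ivl[of c 1 n]
      by (simp_all add: atLeastLessThanSuc_atLeastAtMost)
  qed
  have noise_le: "(\<Sum>t=1..<T. noise (Suc t) \<omega>) \<le> (\<Sum>t=1..T. noise t \<omega>)"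
    "(\<Sum>t=1..<T. noise t \<omega>) \<le> (\<Sum>t=1..T. noise t \<omega>)"
    using decomp(1)[of "\<lambda>t. noise t \<omega>"] decomp(2)[of "\<lambda>t. noise t \<omega>"]
      noise_nonneg[of 1 \<omega>] noise_nonneg[of T \<omega>] by linarith+
  \<comment> \<open>The prediction 0 of round 1 makes this term \<open>G\<^sup>2\<close> rather than
    \<open>4 * G\<^sup>2\<close>.\<close>
  have "(norm (g 1 \<omega> - M 1 \<omega>))\<^sup>2 \<le> G\<^sup>2"
    using assms(2) T_ge by (auto simp: M_eq intro!: power_mono)
  moreover have "(\<Sum>t=1..<T. (norm (g (Suc t) \<omega> - M (Suc t) \<omega>))\<^sup>2)
      \<le> (\<Sum>t=1..<T. 4 * noise (Suc t) \<omega> + 4 * noise t \<omega> + 4 * drift t \<omega>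
          + 4 * L\<^sup>2 * (norm (x t \<omega> - x (Suc t) \<omega>))\<^sup>2)"
    by (intro sum_mono split)
  then have "(\<Sum>t=1..<T. (norm (g (Suc t) \<omega> - M (Suc t) \<omega>))\<^sup>2)
      \<le> 4 * (\<Sum>t=1..<T. noise (Suc t) \<omega>) + 4 * (\<Sum>t=1..<T. noise t \<omega>) + 4 * (\<Sum>t=1..<T. drift t \<omega>)
        + 4 * L\<^sup>2 * (\<Sum>t=1..<T. (norm (x t \<omega> - x (Suc t) \<omega>))\<^sup>2)"
    by (simp add: sum.distrib sum_distrib_left)
  ultimately show ?thesis
    using noise_le unfolding decomp(1)[of "\<lambda>t. (norm (g t \<omega> - M t \<omega>))\<^sup>2"] by linarith
qed

text \<open>Subadditivity of the square root separates the four contributions; the one with the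
  movement \<open>Q\<close> of the iterates is cancelled against the negative term kept in
  \<open>path_regret_le\<close>.\<close>

lemma path_regret_smooth_le:
  assumes "\<omega> \<in> space P" "\<forall>t\<in>{1..T}. norm (g t \<omega>) \<le> G" "u \<in> X"
    and L: "\<forall>K\<in>\<DD>. L-lipschitz_on X (mean_grad df K)"
  shows "regret T (\<lambda>t. g t \<omega>) (\<lambda>t. x t \<omega>) u \<le>
      6 * D * sqrt (\<Sum>t=1..T. noise t \<omega>) + 3 * sqrt 2 * D * sqrt (\<Sum>t=1..<T. drift t \<omega>)
      + (3 * sqrt 2 * D * G / 2 + \<nu> + 1 / \<nu> * (4 * D\<^sup>2 * G\<^sup>2 + 9 * L\<^sup>2 * D ^ 4))"
proof -
  define E H Q where "E = (\<Sum>t=1..T. noise t \<omega>)" and "H = (\<Sum>t=1..<T. drift t \<omega>)"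
    and "Q = (\<Sum>t=1..<T. (norm (x t \<omega> - x (Suc t) \<omega>))\<^sup>2)"
  have nonneg: "0 \<le> E" "0 \<le> H" "0 \<le> Q"
    by (simp_all add: E_def H_def Q_def noise_nonneg drift_nonneg sum_nonneg)
  \<comment> \<open>Nonnegativity of the constant is part of \<open>lipschitz_on\<close>;
    \<open>\<D> 1 \<omega>\<close> witnesses that \<open>\<DD>\<close> is nonempty.\<close>
  have "0 \<le> L"
    using L \<D>_in[of 1 \<omega>] T_ge assms(1) by (auto dest!: bspec intro: lipschitz_on_nonneg)
  have "sqrt (\<Sum>t=1..T. (norm (g t \<omega> - M t \<omega>))\<^sup>2) \<le> sqrt (G\<^sup>2 + 8 * E + 4 * H + 4 * L\<^sup>2 * Q)"
    using path_variation_le[OF assms(1,2) L] by (simp add: E_def H_def Q_def)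
  also have "\<dots> \<le> sqrt (G\<^sup>2) + sqrt (8 * E) + sqrt (4 * H) + sqrt (4 * L\<^sup>2 * Q)"
    using nonneg by (intro order_trans[OF sqrt_add_le_add_sqrt] add_right_mono) auto
  also have "sqrt (8 * E) = 2 * sqrt 2 * sqrt E"
  proof -
    have "8 * E = 2\<^sup>2 * (2 * E)" by simp
    then show ?thesis by (simp only: real_sqrt_mult real_sqrt_abs)
  qed
  also have "sqrt (4 * L\<^sup>2 * Q) = 2 * L * sqrt Q" using \<open>0 \<le> L\<close> by (simp add: real_sqrt_mult)
  finally have "sqrt (\<Sum>t=1..T. (norm (g t \<omega> - M t \<omega>))\<^sup>2) \<le> G + 2 * sqrt 2 * sqrt E + 2 * sqrt H + 2 * L * sqrt Q"
    using G_nonneg by (simp add: real_sqrt_mult)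
  then have "3 / 2 * sqrt 2 * D * sqrt (\<Sum>t=1..T. (norm (g t \<omega> - M t \<omega>))\<^sup>2)
      \<le> 3 / 2 * sqrt 2 * D * (G + 2 * sqrt 2 * sqrt E + 2 * sqrt H + 2 * L * sqrt Q)"
    using D_pos by (intro mult_left_mono) auto
  also have "\<dots> = 3 * sqrt 2 * D * G / 2 + 6 * D * sqrt E + 3 * sqrt 2 * D * sqrt H + 3 * sqrt 2 * D * L * sqrt Q"
    by (simp add: algebra_simps)
  finally have 1: "3 / 2 * sqrt 2 * D * sqrt (\<Sum>t=1..T. (norm (g t \<omega> - M t \<omega>))\<^sup>2) \<le> \<dots>" .
  \<comment> \<open>A quadratic in \<open>sqrt Q\<close>; its maximum is the source of the term
    \<open>9 * L\<^sup>2 * D ^ 4 / \<nu>\<close>.\<close>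
  have "3 * sqrt 2 * D * L * sqrt Q - \<nu> / (2 * D\<^sup>2) * (sqrt Q)\<^sup>2
      \<le> (3 * sqrt 2 * D * L)\<^sup>2 / (4 * (\<nu> / (2 * D\<^sup>2)))"
    using \<nu>_pos D_pos by (intro linear_minus_quadratic_le) simp
  also have "\<dots> = 9 * L\<^sup>2 * D ^ 4 / \<nu>"
    using \<nu>_pos D_pos by (simp add: power_mult_distrib field_simps power2_eq_square power4_eq_xxxx)
  finally have 2: "3 * sqrt 2 * D * L * sqrt Q - \<nu> / (2 * D\<^sup>2) * Q \<le> 9 * L\<^sup>2 * D ^ 4 / \<nu>"
    using nonneg by simp
  have 3: "1 / \<nu> * (4 * D\<^sup>2 * G\<^sup>2 + 9 * L\<^sup>2 * D ^ 4) = 4 * D\<^sup>2 * G\<^sup>2 / \<nu> + 9 * L\<^sup>2 * D ^ 4 / \<nu>"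
    by (simp add: add_divide_distrib)
  show ?thesis
    using path_regret_le[OF assms(1-3)] 1 2 unfolding 3 E_def[symmetric] H_def[symmetric] Q_def[symmetric]
    by linarith
qed

section \<open>Noise, drift and regret in expectation\<close>

lemma measurable_noise: "t \<in> {1..T} \<Longrightarrow> noise t \<in> borel_measurable P"
  unfolding noise_def[abs_def]
  using measurable_mean_grad[OF measurable_\<D>_P measurable_x_P] measurable_g_P by simp

lemma measurable_drift: "t \<in> {1..<T} \<Longrightarrow> drift t \<in> borel_measurable P"
  unfolding drift_def[abs_def]
  using measurable_mean_grad[OF measurable_\<D>_P[of "Suc t"] measurable_x_P[of "Suc t"]]
    measurable_mean_grad[OF measurable_\<D>_P[of t] measurable_x_P[of "Suc t"]] by simp

lemma sqrt_mean_mult_sqrt: "sqrt (1 / real T * c) * sqrt (real T) = sqrt c"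
  using T_ge by (simp flip: real_sqrt_mult)

text \<open>Integrals and sums are interchanged only for \<open>noise\<close> and for the variance
  at the iterate, both measurable. The maximal variance may fail to be measurable, so it enters last
  and by monotonicity alone.\<close>

lemma
  shows integrable_sqrt_noise: "integrable P (\<lambda>\<omega>. sqrt (\<Sum>t=1..T. noise t \<omega>))"
    and integral_sqrt_noise_le:
      "(\<integral>\<omega>. sqrt (\<Sum>t=1..T. noise t \<omega>) \<partial>P) \<le> sigma_bar X df T P \<D> * sqrt (real T)"
proof -
  let ?Z = "\<integral>\<^sup>+\<omega>. ennreal (\<Sum>t=1..T. max_variance X df (\<D> t \<omega>)) \<partial>P"
  have meas: "(\<lambda>\<omega>. \<Sum>t=1..T. noise t \<omega>) \<in> borel_measurable P"
    by (intro borel_measurable_sum measurable_noise)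
  have bound: "AE \<omega> in P. (\<Sum>t=1..T. noise t \<omega>) \<le> (\<Sum>t=1..T. 4 * G\<^sup>2)"
    using AE_norms_g_le AE_space
  proof eventually_elim
    case (elim \<omega>)
    show ?case
    proof (intro sum_mono)
      fix t assume t: "t \<in> {1..T}"
      have "norm (g t \<omega> - mean_grad df (\<D> t \<omega>) (x t \<omega>)) \<le> 2 * G"
        using norm_triangle_ineq4[of "g t \<omega>" "mean_grad df (\<D> t \<omega>) (x t \<omega>)"] bspec[OF elim(1) t]
          norm_mean_grad_le[OF \<D>_in[OF t elim(2)] x_in[OF t elim(2)]] by linarith
      then have "noise t \<omega> \<le> (2 * G)\<^sup>2" unfolding noise_def by (rule power_mono) simp
      then show "noise t \<omega> \<le> 4 * G\<^sup>2" by (simp add: power_mult_distrib)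
    qed
  qed
  have "(\<integral>\<^sup>+\<omega>. ennreal (\<Sum>t=1..T. noise t \<omega>) \<partial>P) = (\<Sum>t=1..T. \<integral>\<^sup>+\<omega>. ennreal (noise t \<omega>) \<partial>P)"
    using measurable_noise
    by (subst nn_integral_sum[symmetric]) (auto simp: noise_nonneg sum_ennreal)
  also have "\<dots> = (\<Sum>t=1..T. \<integral>\<^sup>+\<omega>. ennreal (grad_variance df (\<D> t \<omega>) (x t \<omega>)) \<partial>P)"
    unfolding noise_def by (intro sum.cong nn_integral_noise refl)
  also have "\<dots> = (\<integral>\<^sup>+\<omega>. (\<Sum>t=1..T. ennreal (grad_variance df (\<D> t \<omega>) (x t \<omega>))) \<partial>P)"
    using measurable_grad_variance[OF measurable_\<D>_P measurable_x_P]
    by (subst nn_integral_sum) auto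
  also have "\<dots> \<le> ?Z"
  proof (intro nn_integral_mono)
    fix \<omega> assume \<omega>: "\<omega> \<in> space P"
    have "(\<Sum>t=1..T. ennreal (grad_variance df (\<D> t \<omega>) (x t \<omega>)))
        = ennreal (\<Sum>t=1..T. grad_variance df (\<D> t \<omega>) (x t \<omega>))"
      using grad_variance_nonneg[OF \<D>_in[OF _ \<omega>] x_in[OF _ \<omega>]] by (intro sum_ennreal) auto
    also have "\<dots> \<le> ennreal (\<Sum>t=1..T. max_variance X df (\<D> t \<omega>))"
      using grad_variance_le_max[OF \<D>_in[OF _ \<omega>] x_in[OF _ \<omega>]]
      by (intro ennreal_leI sum_mono) auto
    finally show "(\<Sum>t=1..T. ennreal (grad_variance df (\<D> t \<omega>) (x t \<omega>)))
        \<le> ennreal (\<Sum>t=1..T. max_variance X df (\<D> t \<omega>))" .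
  qed
  finally have le: "(\<integral>\<^sup>+\<omega>. ennreal (\<Sum>t=1..T. noise t \<omega>) \<partial>P) \<le> ?Z" .
  have "?Z \<le> (\<integral>\<^sup>+\<omega>. ennreal (\<Sum>t=1..T. 4 * G\<^sup>2) \<partial>P)"
    by (intro nn_integral_mono ennreal_leI sum_mono max_variance_le \<D>_in)
  also have "\<dots> < \<infinity>" by (simp add: emeasure_space_1 ennreal_mult_less_top)
  finally have fin: "?Z < \<infinity>" .
  note * = integral_sqrt_le[OF meas _ bound le fin]
  show "integrable P (\<lambda>\<omega>. sqrt (\<Sum>t=1..T. noise t \<omega>))"
    by (rule *(1)) (simp add: noise_nonneg sum_nonneg)
  show "(\<integral>\<omega>. sqrt (\<Sum>t=1..T. noise t \<omega>) \<partial>P) \<le> sigma_bar X df T P \<D> * sqrt (real T)"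
    unfolding sigma_bar_def sqrt_mean_mult_sqrt by (rule *(2)) (simp add: noise_nonneg sum_nonneg)
qed

lemma
  shows integrable_sqrt_drift: "integrable P (\<lambda>\<omega>. sqrt (\<Sum>t=1..<T. drift t \<omega>))"
    and integral_sqrt_drift_le:
      "(\<integral>\<omega>. sqrt (\<Sum>t=1..<T. drift t \<omega>) \<partial>P) \<le> Sigma_bar X df T P \<D> * sqrt (real T)"
proof -
  define sh where "sh t \<omega> = grad_shift X df (\<D> t \<omega>) (if t = 1 then \<D> 1 \<omega> else \<D> (t - 1) \<omega>)" for t \<omega>
  let ?Z = "\<integral>\<^sup>+\<omega>. ennreal (\<Sum>t=1..T. sh t \<omega>) \<partial>P"
  have meas: "(\<lambda>\<omega>. \<Sum>t=1..<T. drift t \<omega>) \<in> borel_measurable P"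
    by (intro borel_measurable_sum measurable_drift)
  have sh: "0 \<le> sh t \<omega>" "sh t \<omega> \<le> 4 * G\<^sup>2" if "t \<in> {1..T}" "\<omega> \<in> space P" for t \<omega>
  proof -
    have "t = 1 \<or> t - 1 \<in> {1..T}" using that by auto
    then have "(if t = 1 then \<D> 1 \<omega> else \<D> (t - 1) \<omega>) \<in> \<DD>"
      using that \<D>_in by auto
    with \<D>_in[OF that] show "0 \<le> sh t \<omega>" "sh t \<omega> \<le> 4 * G\<^sup>2"
      unfolding sh_def by (rule grad_shift_nonneg, rule grad_shift_le)
  qed
  have drift_le: "(\<Sum>t=1..<T. drift t \<omega>) \<le> (\<Sum>t=1..T. sh t \<omega>)" if \<omega>: "\<omega> \<in> space P" for \<omega>
  proof -
    have "(\<Sum>t=1..<T. drift t \<omega>) \<le> (\<Sum>t=1..<T. sh (Suc t) \<omega>)"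
      using \<omega> unfolding drift_def sh_def
      by (intro sum_mono) (auto intro!: norm_mean_grad_diff_le_shift \<D>_in x_in)
    also have "\<dots> = (\<Sum>t=Suc 1..T. sh t \<omega>)"
      by (simp only: atLeastLessThanSuc_atLeastAtMost[symmetric] sum.shift_bounds_Suc_ivl)
    \<comment> \<open>The added summand \<open>sh 1\<close> compares \<open>\<D> 1\<close> with
      itself, following the convention for round 0.\<close>
    also have "\<dots> \<le> (\<Sum>t=1..T. sh t \<omega>)"
      using sh(1)[OF _ \<omega>] by (intro sum_mono2) auto
    finally show ?thesis .
  qed
  have sh_bound: "(\<Sum>t=1..T. sh t \<omega>) \<le> (\<Sum>t=1..T. 4 * G\<^sup>2)" if "\<omega> \<in> space P" for \<omega>
    using sh(2)[OF _ that] by (intro sum_mono)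
  have bound: "AE \<omega> in P. (\<Sum>t=1..<T. drift t \<omega>) \<le> (\<Sum>t=1..T. 4 * G\<^sup>2)"
    using drift_le sh_bound by (intro AE_I2) (blast intro: order_trans)
  have le: "(\<integral>\<^sup>+\<omega>. ennreal (\<Sum>t=1..<T. drift t \<omega>) \<partial>P) \<le> ?Z"
    using drift_le by (intro nn_integral_mono ennreal_leI)
  have "?Z \<le> (\<integral>\<^sup>+\<omega>. ennreal (\<Sum>t=1..T. 4 * G\<^sup>2) \<partial>P)"
    using sh_bound by (intro nn_integral_mono ennreal_leI)
  also have "\<dots> < \<infinity>" by (simp add: emeasure_space_1 ennreal_mult_less_top)
  finally have fin: "?Z < \<infinity>" .
  note * = integral_sqrt_le[OF meas _ bound le fin]
  show "integrable P (\<lambda>\<omega>. sqrt (\<Sum>t=1..<T. drift t \<omega>))"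
    by (rule *(1)) (simp add: drift_nonneg sum_nonneg)
  show "(\<integral>\<omega>. sqrt (\<Sum>t=1..<T. drift t \<omega>) \<partial>P) \<le> Sigma_bar X df T P \<D> * sqrt (real T)"
    unfolding Sigma_bar_def sh_def[symmetric] sqrt_mean_mult_sqrt
    by (rule *(2)) (simp add: drift_nonneg sum_nonneg)
qed

lemma expected_regret_le:
  assumes L: "\<forall>K\<in>\<DD>. L-lipschitz_on X (mean_grad df K)" and "u \<in> X"
  shows "(\<integral>\<omega>. regret T (\<lambda>t. g t \<omega>) (\<lambda>t. x t \<omega>) u \<partial>P)
    \<le> D * (6 * sigma_bar X df T P \<D> + 3 * sqrt 2 * Sigma_bar X df T P \<D>) * sqrt (real T)
      + 3 * sqrt 2 * D * G / 2 + \<nu> + 1 / \<nu> * (4 * D\<^sup>2 * G\<^sup>2 + 9 * L\<^sup>2 * D ^ 4)"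
proof -
  define C where "C = 3 * sqrt 2 * D * G / 2 + \<nu> + 1 / \<nu> * (4 * D\<^sup>2 * G\<^sup>2 + 9 * L\<^sup>2 * D ^ 4)"
  have "0 \<le> C" using D_pos G_nonneg \<nu>_pos by (simp add: C_def)
  define R where "R \<omega> = 6 * D * sqrt (\<Sum>t=1..T. noise t \<omega>) + 3 * sqrt 2 * D * sqrt (\<Sum>t=1..<T. drift t \<omega>) + C" for \<omega>
  have "(\<integral>\<omega>. regret T (\<lambda>t. g t \<omega>) (\<lambda>t. x t \<omega>) u \<partial>P) \<le> (\<integral>\<omega>. R \<omega> \<partial>P)"
  \<comment> \<open>Only the upper bound \<open>R\<close> is shown to be integrable; its
    nonnegativity covers the default value 0 of the Bochner integral.\<close>
  proof (rule integral_mono_AE')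
    show "integrable P R"
      unfolding R_def[abs_def] using integrable_sqrt_noise integrable_sqrt_drift by simp
    show "AE \<omega> in P. regret T (\<lambda>t. g t \<omega>) (\<lambda>t. x t \<omega>) u \<le> R \<omega>"
      using AE_norms_g_le AE_space
      by eventually_elim (unfold R_def C_def, rule path_regret_smooth_le[OF _ _ \<open>u \<in> X\<close> L])
    show "AE \<omega> in P. 0 \<le> R \<omega>"
      using D_pos \<open>0 \<le> C\<close> by (auto simp: R_def noise_nonneg drift_nonneg sum_nonneg)
  qed
  also have "\<dots> = 6 * D * (\<integral>\<omega>. sqrt (\<Sum>t=1..T. noise t \<omega>) \<partial>P)
      + 3 * sqrt 2 * D * (\<integral>\<omega>. sqrt (\<Sum>t=1..<T. drift t \<omega>) \<partial>P) + C"
    unfolding R_def using integrable_sqrt_noise integrable_sqrt_drift by (simp add: prob_space)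
  also have "\<dots> \<le> 6 * D * (sigma_bar X df T P \<D> * sqrt (real T))
      + 3 * sqrt 2 * D * (Sigma_bar X df T P \<D> * sqrt (real T)) + C"
    using D_pos integral_sqrt_noise_le integral_sqrt_drift_le
    by (intro add_mono mult_left_mono order_refl) auto
  finally show ?thesis by (simp add: C_def algebra_simps)
qed

text \<open>With \<open>a = D * G\<close>, \<open>b = L * D\<^sup>2\<close> and
  \<open>\<nu> = b + a\<close>, the quotient by \<open>\<nu>\<close> is at most
  \<open>4 * a + 9 * b\<close>. The constant 10 is dictated by \<open>b\<close>, which occurs once
  in \<open>\<nu>\<close> and nine times in that quotient.\<close>

lemma expected_regret_tuned_le:
  assumes L: "\<forall>K\<in>\<DD>. L-lipschitz_on X (mean_grad df K)" and "u \<in> X"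
    and \<nu>: "\<nu> = L * D\<^sup>2 + D * G"
  shows "(\<integral>\<omega>. regret T (\<lambda>t. g t \<omega>) (\<lambda>t. x t \<omega>) u \<partial>P)
    \<le> 10 * (D * (sigma_bar X df T P \<D> + Sigma_bar X df T P \<D>) * sqrt (real T) + D * G + L * D\<^sup>2)"
proof -
  define a b where "a = D * G" and "b = L * D\<^sup>2"
  obtain \<omega> where "\<omega> \<in> space P" using not_empty by blast
  then have "0 \<le> L"
    using L \<D>_in[of 1 \<omega>] T_ge by (auto dest!: bspec intro: lipschitz_on_nonneg)
  then have "0 \<le> a" "0 \<le> b" using D_pos G_nonneg by (simp_all add: a_def b_def)
  have "\<nu> = b + a" by (simp add: \<nu> a_def b_def)
  define \<sigma> \<Sigma> where "\<sigma> = D * sqrt (real T) * sigma_bar X df T P \<D>"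
    and "\<Sigma> = D * sqrt (real T) * Sigma_bar X df T P \<D>"
  have "0 \<le> \<sigma>" "0 \<le> \<Sigma>" using D_pos by (simp_all add: \<sigma>_def \<Sigma>_def sigma_bar_def Sigma_bar_def)
  have "sqrt 2 \<le> 2" by (rule real_le_lsqrt) auto
  define q where "q = 1 / \<nu> * (4 * D\<^sup>2 * G\<^sup>2 + 9 * L\<^sup>2 * D ^ 4)"
  have "q = (4 * a\<^sup>2 + 9 * b\<^sup>2) / \<nu>"
    by (simp add: q_def a_def b_def power_mult_distrib flip: power_mult)
  \<comment> \<open>The product of \<open>4 * a + 9 * b\<close> and \<open>a + b\<close> exceeds the
    numerator by \<open>13 * a * b\<close>.\<close>
  also have "\<dots> \<le> 4 * a + 9 * b"
    using \<nu>_pos \<open>0 \<le> a\<close> \<open>0 \<le> b\<close> by (simp add: \<open>\<nu> = b + a\<close> pos_divide_le_eq power2_eq_square algebra_simps)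
  finally have 1: "q \<le> 4 * a + 9 * b" .
  have 2: "sqrt 2 * \<Sigma> \<le> 2 * \<Sigma>" "sqrt 2 * a \<le> 2 * a"
    using \<open>sqrt 2 \<le> 2\<close> \<open>0 \<le> \<Sigma>\<close> \<open>0 \<le> a\<close> by (auto intro: mult_right_mono)
  have "(\<integral>\<omega>. regret T (\<lambda>t. g t \<omega>) (\<lambda>t. x t \<omega>) u \<partial>P)
      \<le> 6 * \<sigma> + 3 * (sqrt 2 * \<Sigma>) + 3 / 2 * (sqrt 2 * a) + \<nu> + q"
    using expected_regret_le[OF L \<open>u \<in> X\<close>] by (simp add: q_def \<sigma>_def \<Sigma>_def a_def algebra_simps)
  also have "\<dots> \<le> 10 * (\<sigma> + \<Sigma> + a + b)"
  proof -
    have "6 * \<sigma> + 3 * (sqrt 2 * \<Sigma>) + 3 / 2 * (sqrt 2 * a) + \<nu> + q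
        \<le> 6 * \<sigma> + 3 * (2 * \<Sigma>) + 3 / 2 * (2 * a) + (b + a) + (4 * a + 9 * b)"
      using 1 2 \<open>\<nu> = b + a\<close> by (intro add_mono mult_left_mono) auto
    also have "\<dots> \<le> 10 * (\<sigma> + \<Sigma> + a + b)"
      using \<open>0 \<le> a\<close> \<open>0 \<le> b\<close> \<open>0 \<le> \<sigma>\<close> \<open>0 \<le> \<Sigma>\<close> by simp
    finally show ?thesis .
  qed
  finally show ?thesis by (simp add: \<sigma>_def \<Sigma>_def a_def b_def algebra_simps)
qed

end

text \<open>The constant 10 makes the order bound explicit and uniform in all data. The bound
  without expectations holds almost surely because the gradient bound does, and its null set is the
  same for all \<open>u\<close>.\<close>

theorem theorem5:
  fixes X :: "(real^'d) set" and S :: "'xi measure" and \<DD> :: "'xi measure set"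
    and f :: "real^'d \<Rightarrow> 'xi \<Rightarrow> real" and df :: "real^'d \<Rightarrow> 'xi \<Rightarrow> real^'d"
    and T :: nat and P :: "'w measure" and \<F> :: "nat \<Rightarrow> 'w measure"
    and \<D> :: "nat \<Rightarrow> 'w \<Rightarrow> 'xi measure" and \<xi> :: "nat \<Rightarrow> 'w \<Rightarrow> 'xi"
    and x g M :: "nat \<Rightarrow> 'w \<Rightarrow> real^'d" and \<eta> :: "nat \<Rightarrow> 'w \<Rightarrow> real"
    and D G \<nu> :: real
  assumes "closed X" and "bounded X" and "convex X"
    and "D = diameter X"
    and "\<forall>y\<in>X. norm y \<le> D"
    and "\<DD> \<subseteq> space (prob_algebra S)"
    and "gradient_on X S f df"
    and "T \<ge> 1"
    and "sea_protocol S \<DD> T P \<F> \<D> \<xi>"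
    and "\<forall>t \<omega>. g t \<omega> = df (x t \<omega>) (\<xi> t \<omega>)"
    and "\<forall>t \<omega>. M t \<omega> = (if t = 1 then 0 else g (t - 1) \<omega>)"
    and "\<nu> > 0"
    and "\<forall>\<omega>\<in>space P. adaptive_step D \<nu> T (\<lambda>t. M t \<omega>) (\<lambda>t. g t \<omega>) (\<lambda>t. \<eta> t \<omega>)"
    and "\<forall>\<omega>\<in>space P. oftrl X T (\<lambda>t. \<eta> t \<omega>) (\<lambda>t. M t \<omega>) (\<lambda>t. g t \<omega>) (\<lambda>t. x t \<omega>)"
    and "\<forall>\<D>'\<in>\<DD>. convex_bounded_grad X f df G \<D>'"
  shows
    "(\<forall>L. (\<forall>\<D>'\<in>\<DD>. smooth_mean X df L \<D>' \<and> finite_variance X df \<D>') \<longrightarrow>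
       (\<forall>u\<in>X.
          (\<integral>\<omega>. regret T (\<lambda>t. g t \<omega>) (\<lambda>t. x t \<omega>) u \<partial>P)
            \<le> D * (6 * sigma_bar X df T P \<D> + 3 * sqrt 2 * Sigma_bar X df T P \<D>) * sqrt (real T)
              + 3 * sqrt 2 * D * G / 2 + \<nu> + 1 / \<nu> * (4 * D\<^sup>2 * G\<^sup>2 + 9 * L\<^sup>2 * D ^ 4)) \<and>
       (\<nu> = L * D\<^sup>2 + D * G \<longrightarrow>
         (\<forall>u\<in>X.
            (\<integral>\<omega>. regret T (\<lambda>t. g t \<omega>) (\<lambda>t. x t \<omega>) u \<partial>P)
              \<le> 10 * (D * (sigma_bar X df T P \<D> + Sigma_bar X df T P \<D>) * sqrt (real T)
                       + D * G + L * D\<^sup>2)))) \<and>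
     (\<nu> = 2 * D * G \<longrightarrow>
       (AE \<omega> in P. \<forall>u\<in>X.
          regret T (\<lambda>t. g t \<omega>) (\<lambda>t. x t \<omega>) u \<le> 3 * sqrt 2 * D * G * sqrt (real T) + 4 * D * G))"
proof (cases "D = 0")
  \<comment> \<open>With diameter zero the normalisation leaves only the origin in \<open>X\<close>,
    so the regret vanishes. Both tuned values of \<open>\<nu>\<close> would be 0, contradicting
    \<open>\<nu> > 0\<close>.\<close>
  case True
  have X0: "y = 0" if "y \<in> X" for y using assms(5) True that by auto
  have "regret T (\<lambda>t. g t \<omega>) (\<lambda>t. x t \<omega>) u = 0" if "\<omega> \<in> space P" "u \<in> X" for \<omega> u
  proof -
    have "x t \<omega> = 0" if "t \<in> {1..T}" for t
      using assms(14) \<open>\<omega> \<in> space P\<close> that by (intro X0) (auto simp: oftrl_def is_arg_min_def)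
    then show ?thesis using X0[OF \<open>u \<in> X\<close>] by (simp add: regret_def)
  qed
  then have "(\<integral>\<omega>. regret T (\<lambda>t. g t \<omega>) (\<lambda>t. x t \<omega>) u \<partial>P) = (\<integral>\<omega>. 0 \<partial>P)" if "u \<in> X" for u
    using that by (intro Bochner_Integration.integral_cong) auto
  then have zero: "(\<integral>\<omega>. regret T (\<lambda>t. g t \<omega>) (\<lambda>t. x t \<omega>) u \<partial>P) = 0" if "u \<in> X" for u
    using that by simp
  show ?thesis
    using \<open>\<nu> > 0\<close> by (intro conjI allI impI ballI) (simp_all add: zero True)
next
  case False
  then have "0 < D" using diameter_ge_0[OF \<open>bounded X\<close>] \<open>D = diameter X\<close> by simp
  interpret prob_space P using assms(9) by (simp add: sea_protocol_def)
  interpret sea_oftrl P X S \<DD> df T \<F> \<D> \<xi> x g M \<eta> D G \<nu>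
  proof (unfold_locales)
    show "AE \<xi> in K. \<forall>y\<in>X. norm (df y \<xi>) \<le> G" if "K \<in> \<DD>" for K
      using bspec[OF assms(15) that] unfolding convex_bounded_grad_def by (rule eventually_mono) blast
    show "(\<lambda>(x, \<xi>). df x \<xi>) \<in> borel_measurable (restrict_space borel X \<Otimes>\<^sub>M S)"
      using assms(7) by (simp add: gradient_on_def)
    show "adaptive_step D \<nu> T (\<lambda>t. M t \<omega>) (\<lambda>t. g t \<omega>) (\<lambda>t. \<eta> t \<omega>)" if "\<omega> \<in> space P" for \<omega>
      using assms(13) that by (rule bspec)
    show "oftrl X T (\<lambda>t. \<eta> t \<omega>) (\<lambda>t. M t \<omega>) (\<lambda>t. g t \<omega>) (\<lambda>t. x t \<omega>)" if "\<omega> \<in> space P" for \<omega>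
      using assms(14) that by (rule bspec)
    show "g t \<omega> = df (x t \<omega>) (\<xi> t \<omega>)" for t \<omega> using assms(10) by blast
    show "M t \<omega> = (if t = 1 then 0 else g (t - 1) \<omega>)" for t \<omega> using assms(11) by blast
  qed (fact assms \<open>0 < D\<close>)+
  show ?thesis
    unfolding smooth_mean_def
    using expected_regret_le expected_regret_tuned_le AE_regret_le by blast
qed

end
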